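(* Let $b\neq0$ be a real constant, let $f(x,y)=\dfrac{-2e^{bx}}{b^2}$, and let $(M,g_f)$ be the homogeneous three-dimensional Lorentzian strictly Walker manifold of type $\mathcal N_b$, with coordinates $(t,x,y)$ and metric $g_f=2\,dt\,dy+dx^2+f(x,y)\,dy^2$. An arbitrary smooth vector field $X=X_1\partial_t+X_2\partial_x+X_3\partial_y$ on $M$: - is homothetic (equivalently, Killing) if and only if $$X_1=c_1t+c_2,\qquad X_2=\frac{2c_1}{b},\qquad X_3=-c_1y+c_3$$ for some real constants $c_1,c_2,c_3$; - is affine if and only if $$X_1=c_1t+c_2+c_4y,\qquad X_2=\frac{2c_1}{b},\qquad X_3=-c_1y+c_3$$ for some real constants $c_1,c_2,c_3,c_4$; - is a Ricci collineation if and only if $X_1$ is arbitrary and $$X_2=-\frac2b f_1'(y),\qquad X_3=f_1(y)$$ for some smooth function $f_1$ of $y$; - is a curvature collineation if and only if $$X_1=f_2(y)-f_1'(y)t+\frac2b f_1''(y)x,\qquad X_2=-\frac2b f_1'(y),\qquad X_3=f_1(y)$$ for some smooth functions $f_1,f_2$ of $y$.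
   Context: The statement is local: the coordinates $(t,x,y)$ range over a product of open intervals. In the coordinate frame, $g_f(\partial_t,\partial_y)=1$, $g_f(\partial_x,\partial_x)=1$, $g_f(\partial_y,\partial_y)=f(x,y)$, and all other components vanish. Let $\mathcal L$ denote the Lie derivative, $\nabla$ the Levi-Civita connection, $R$ the curvature tensor (as a $(1,3)$-tensor) and $\varrho$ the Ricci tensor of $g_f$. A vector field $X$ is Killing if $\mathcal L_Xg_f=0$; homothetic if $\mathcal L_Xg_f=\eta g_f$ for some real constant $\eta$; affine if $\mathcal L_X\nabla=0$; a Ricci collineation if $\mathcal L_X\varrho=0$; a curvature collineation if $\mathcal L_XR=0$. *)

theory Defs
  imports "HOL-Analysis.Analysis"
begin

text \<open>
  Everything is done on an open subset of \<open>real^'n\<close>, with its Cartesian coordinates as the chart.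
  Vector fields are total functions \<open>real^'n \<Rightarrow> real^'n\<close> and covariant 2-tensor fields are functions
  \<open>h\<close> with \<open>h p u v\<close> the value at \<open>p\<close> on tangent vectors \<open>u\<close>, \<open>v\<close>; only their values on the open set
  matter. The coordinate field with index \<open>i\<close> is the constant function \<open>axis i 1\<close>.
\<close>

primrec ck_on :: "nat \<Rightarrow> 'a::euclidean_space set \<Rightarrow> ('a \<Rightarrow> 'b::real_normed_vector) \<Rightarrow> bool" where
  "ck_on 0 U f \<longleftrightarrow> continuous_on U f"
| "ck_on (Suc k) U f \<longleftrightarrow> (\<forall>p\<in>U. f differentiable at p) \<and>
     (\<forall>v. ck_on k U (\<lambda>p. frechet_derivative f (at p) v))"

definition smooth_on :: "'a::euclidean_space set \<Rightarrow> ('a \<Rightarrow> 'b::real_normed_vector) \<Rightarrow> bool" where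
  "smooth_on U f \<longleftrightarrow> (\<forall>k. ck_on k U f)"

definition lie_bracket ::
    "(real^'n \<Rightarrow> real^'n) \<Rightarrow> (real^'n \<Rightarrow> real^'n) \<Rightarrow> real^'n \<Rightarrow> real^'n" where
  "lie_bracket X Y p = frechet_derivative Y (at p) (X p) - frechet_derivative X (at p) (Y p)"

definition metric_matrix ::
    "(real^'n \<Rightarrow> real^'n \<Rightarrow> real^'n \<Rightarrow> real) \<Rightarrow> real^'n \<Rightarrow> real^'n^'n" where
  "metric_matrix g p = (\<chi> i j. g p (axis i 1) (axis j 1))"

definition metric_partial ::
    "(real^'n \<Rightarrow> real^'n \<Rightarrow> real^'n \<Rightarrow> real) \<Rightarrow> real^'n \<Rightarrow> 'n \<Rightarrow> 'n \<Rightarrow> 'n \<Rightarrow> real" where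
  "metric_partial g p k i j =
     frechet_derivative (\<lambda>q. metric_matrix g q $ i $ j) (at p) (axis k 1)"

text \<open>\<open>christoffel g p k i j\<close> is the Christoffel symbol with upper index \<open>k\<close> and lower indices
  \<open>i\<close>, \<open>j\<close>.\<close>

definition christoffel ::
    "(real^'n \<Rightarrow> real^'n \<Rightarrow> real^'n \<Rightarrow> real) \<Rightarrow> real^'n \<Rightarrow> 'n \<Rightarrow> 'n \<Rightarrow> 'n \<Rightarrow> real" where
  "christoffel g p k i j =
     (1/2) * (\<Sum>l\<in>UNIV. matrix_inv (metric_matrix g p) $ k $ l *
        (metric_partial g p i j l + metric_partial g p j i l - metric_partial g p l i j))"

definition levi_civita ::
    "(real^'n \<Rightarrow> real^'n \<Rightarrow> real^'n \<Rightarrow> real) \<Rightarrow>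
     (real^'n \<Rightarrow> real^'n) \<Rightarrow> (real^'n \<Rightarrow> real^'n) \<Rightarrow> real^'n \<Rightarrow> real^'n" where
  "levi_civita g X Y p = frechet_derivative Y (at p) (X p) +
     (\<chi> k. \<Sum>i\<in>UNIV. \<Sum>j\<in>UNIV. christoffel g p k i j * X p $ i * Y p $ j)"

definition curvature_op ::
    "(real^'n \<Rightarrow> real^'n \<Rightarrow> real^'n \<Rightarrow> real) \<Rightarrow>
     (real^'n \<Rightarrow> real^'n) \<Rightarrow> (real^'n \<Rightarrow> real^'n) \<Rightarrow> (real^'n \<Rightarrow> real^'n) \<Rightarrow> real^'n \<Rightarrow> real^'n" where
  "curvature_op g X Y Z p =
     levi_civita g X (levi_civita g Y Z) p - levi_civita g Y (levi_civita g X Z) p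
       - levi_civita g (lie_bracket X Y) Z p"

text \<open>The value of the curvature tensor on tangent vectors at \<open>p\<close> does not depend on how these are
  extended to vector fields; we extend them with constant components.\<close>

definition curvature_tensor ::
    "(real^'n \<Rightarrow> real^'n \<Rightarrow> real^'n \<Rightarrow> real) \<Rightarrow>
     real^'n \<Rightarrow> real^'n \<Rightarrow> real^'n \<Rightarrow> real^'n \<Rightarrow> real^'n" where
  "curvature_tensor g p u v w = curvature_op g (\<lambda>_. u) (\<lambda>_. v) (\<lambda>_. w) p"

definition ricci ::
    "(real^'n \<Rightarrow> real^'n \<Rightarrow> real^'n \<Rightarrow> real) \<Rightarrow> real^'n \<Rightarrow> real^'n \<Rightarrow> real^'n \<Rightarrow> real" where
  "ricci g p v w = (\<Sum>i\<in>UNIV. curvature_tensor g p (axis i 1) v w $ i)"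

text \<open>Lie derivatives along \<open>X\<close>, as functions of vector fields, by the Leibniz rule.\<close>

definition lie_deriv_form ::
    "(real^'n \<Rightarrow> real^'n) \<Rightarrow> (real^'n \<Rightarrow> real^'n \<Rightarrow> real^'n \<Rightarrow> real) \<Rightarrow>
     (real^'n \<Rightarrow> real^'n) \<Rightarrow> (real^'n \<Rightarrow> real^'n) \<Rightarrow> real^'n \<Rightarrow> real" where
  "lie_deriv_form X h Y Z p =
     frechet_derivative (\<lambda>q. h q (Y q) (Z q)) (at p) (X p)
       - h p (lie_bracket X Y p) (Z p) - h p (Y p) (lie_bracket X Z p)"

definition lie_deriv_connection ::
    "(real^'n \<Rightarrow> real^'n) \<Rightarrow>
     ((real^'n \<Rightarrow> real^'n) \<Rightarrow> (real^'n \<Rightarrow> real^'n) \<Rightarrow> real^'n \<Rightarrow> real^'n) \<Rightarrow>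
     (real^'n \<Rightarrow> real^'n) \<Rightarrow> (real^'n \<Rightarrow> real^'n) \<Rightarrow> real^'n \<Rightarrow> real^'n" where
  "lie_deriv_connection X D Y Z p =
     lie_bracket X (D Y Z) p - D (lie_bracket X Y) Z p - D Y (lie_bracket X Z) p"

definition lie_deriv_tensor13 ::
    "(real^'n \<Rightarrow> real^'n) \<Rightarrow> (real^'n \<Rightarrow> real^'n \<Rightarrow> real^'n \<Rightarrow> real^'n \<Rightarrow> real^'n) \<Rightarrow>
     (real^'n \<Rightarrow> real^'n) \<Rightarrow> (real^'n \<Rightarrow> real^'n) \<Rightarrow> (real^'n \<Rightarrow> real^'n) \<Rightarrow> real^'n \<Rightarrow> real^'n" where
  "lie_deriv_tensor13 X R Y Z W p =
     lie_bracket X (\<lambda>q. R q (Y q) (Z q) (W q)) p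
       - R p (lie_bracket X Y p) (Z p) (W p)
       - R p (Y p) (lie_bracket X Z p) (W p)
       - R p (Y p) (Z p) (lie_bracket X W p)"

definition homothetic ::
    "(real^'n) set \<Rightarrow> (real^'n \<Rightarrow> real^'n \<Rightarrow> real^'n \<Rightarrow> real) \<Rightarrow> (real^'n \<Rightarrow> real^'n) \<Rightarrow> bool" where
  "homothetic M g X \<longleftrightarrow> (\<exists>\<eta>::real. \<forall>Y Z. smooth_on M Y \<longrightarrow> smooth_on M Z \<longrightarrow>
     (\<forall>p\<in>M. lie_deriv_form X g Y Z p = \<eta> * g p (Y p) (Z p)))"

definition killing ::
    "(real^'n) set \<Rightarrow> (real^'n \<Rightarrow> real^'n \<Rightarrow> real^'n \<Rightarrow> real) \<Rightarrow> (real^'n \<Rightarrow> real^'n) \<Rightarrow> bool" where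
  "killing M g X \<longleftrightarrow> (\<forall>Y Z. smooth_on M Y \<longrightarrow> smooth_on M Z \<longrightarrow>
     (\<forall>p\<in>M. lie_deriv_form X g Y Z p = 0))"

definition affine_field ::
    "(real^'n) set \<Rightarrow> (real^'n \<Rightarrow> real^'n \<Rightarrow> real^'n \<Rightarrow> real) \<Rightarrow> (real^'n \<Rightarrow> real^'n) \<Rightarrow> bool" where
  "affine_field M g X \<longleftrightarrow> (\<forall>Y Z. smooth_on M Y \<longrightarrow> smooth_on M Z \<longrightarrow>
     (\<forall>p\<in>M. lie_deriv_connection X (levi_civita g) Y Z p = 0))"

definition ricci_collineation ::
    "(real^'n) set \<Rightarrow> (real^'n \<Rightarrow> real^'n \<Rightarrow> real^'n \<Rightarrow> real) \<Rightarrow> (real^'n \<Rightarrow> real^'n) \<Rightarrow> bool" where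
  "ricci_collineation M g X \<longleftrightarrow> (\<forall>Y Z. smooth_on M Y \<longrightarrow> smooth_on M Z \<longrightarrow>
     (\<forall>p\<in>M. lie_deriv_form X (ricci g) Y Z p = 0))"

definition curvature_collineation ::
    "(real^'n) set \<Rightarrow> (real^'n \<Rightarrow> real^'n \<Rightarrow> real^'n \<Rightarrow> real) \<Rightarrow> (real^'n \<Rightarrow> real^'n) \<Rightarrow> bool" where
  "curvature_collineation M g X \<longleftrightarrow>
     (\<forall>Y Z W. smooth_on M Y \<longrightarrow> smooth_on M Z \<longrightarrow> smooth_on M W \<longrightarrow>
       (\<forall>p\<in>M. lie_deriv_tensor13 X (curvature_tensor g) Y Z W p = 0))"

text \<open>From here on the components \<open>1\<close>, \<open>2\<close>, \<open>3\<close> are the coordinates \<open>t\<close>, \<open>x\<close>, \<open>y\<close>. The products of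
  components below are symmetrised: \<open>2 dt dy\<close> is the form with value \<open>1\<close> on the pair of the first and
  third coordinate fields.\<close>

definition walker_metric ::
    "(real \<Rightarrow> real \<Rightarrow> real) \<Rightarrow> real^3 \<Rightarrow> real^3 \<Rightarrow> real^3 \<Rightarrow> real" where
  "walker_metric f p u v =
     u $ 1 * v $ 3 + u $ 3 * v $ 1 + u $ 2 * v $ 2 + f (p $ 2) (p $ 3) * u $ 3 * v $ 3"

definition walker_N :: "real \<Rightarrow> real^3 \<Rightarrow> real^3 \<Rightarrow> real^3 \<Rightarrow> real" where
  "walker_N b = walker_metric (\<lambda>x y. - 2 * exp (b * x) / b\<^sup>2)"

definition coord_box :: "real set \<Rightarrow> real set \<Rightarrow> real set \<Rightarrow> (real^3) set" where
  "coord_box I J K = {p. p $ 1 \<in> I \<and> p $ 2 \<in> J \<and> p $ 3 \<in> K}"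

definition open_interval :: "real set \<Rightarrow> bool" where
  "open_interval I \<longleftrightarrow> open I \<and> is_interval I \<and> I \<noteq> {}"

end

theory Submission
  imports Defs
begin

text \<open>
  The Christoffel symbols, the curvature and the Ricci tensor of the metric are explicit: every
  nonzero component is a constant times \<open>exp (b * x)\<close>. Lie derivatives are
  tensorial, so each symmetry condition is equivalent to a linear system of partial differential
  equations for the components of \<open>X\<close>; for the connection this uses the symmetry of second
  derivatives. The systems are integrated by one device: in an identity
  \<open>exp (b * x) * F + G = 0\<close> with \<open>F\<close> and \<open>G\<close> independent of \<open>x\<close>, both \<open>F\<close> and \<open>G\<close> vanish.
  Hence the exponential and the remaining terms of each equation separate, and what is left says
  that certain partial derivatives are constant or depend on \<open>y\<close> only.
\<close>

subsection \<open>Smooth functions\<close>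

text \<open>Shifting \<open>x\<close> by \<open>s\<close> multiplies \<open>exp (b * x)\<close> by
  \<open>exp (b * s)\<close>. In the \<open>dy^2\<close> term of the metric this is undone by
  scaling \<open>y\<close> with \<open>exp (- b * s / 2)\<close>, and the inverse scaling of
  \<open>t\<close> preserves \<open>dt dy\<close>. This one-parameter group is the origin of the
  constant \<open>2 / b\<close> and of the coupling of the three components through
  \<open>c1\<close>. The Ricci tensor is \<open>exp (b * x) dy^2\<close>, so any change of the
  coordinate \<open>y\<close> can be balanced by a shift of \<open>x\<close> depending on
  \<open>y\<close>: hence the free function \<open>f1\<close>. The extra affine field
  \<open>y\<close> times the first coordinate field exists because that coordinate field and the
  form \<open>dy\<close> are both parallel. The obstacle lies in the homothetic case. There
  \<open>pd 2 B = \<eta> / 2\<close>, so the coefficient of the exponential need not be independent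
  of \<open>x\<close>, and the two parts of an equation do not simply vanish. One differentiation in
  \<open>x\<close> still gives \<open>pd 2 F = - b * F\<close>, and an \<open>F\<close> that is
  affine in \<open>x\<close> satisfies this only when it is zero, which forces
  \<open>\<eta> = 0\<close>.\<close>

lemma smooth_on_differentiable:
  assumes "smooth_on U f" "p \<in> U"
  shows "f differentiable at p"
proof -
  have "ck_on (Suc 0) U f"
    using assms(1) unfolding smooth_on_def by blast
  then show ?thesis
    using assms(2) by simp
qed

lemma smooth_on_imp_continuous_on:
  assumes "smooth_on U f"
  shows "continuous_on U f"
  using assms ck_on.simps(1) unfolding smooth_on_def by blast

lemma smooth_on_frechet_derivative:
  assumes "smooth_on U f"
  shows "smooth_on U (\<lambda>p. frechet_derivative f (at p) v)"
  unfolding smooth_on_def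
proof
  fix k
  have "ck_on (Suc k) U f"
    using assms unfolding smooth_on_def by blast
  then show "ck_on k U (\<lambda>p. frechet_derivative f (at p) v)"
    by simp
qed

text \<open>A derivative at a point of an open set depends only on the values near that point. The
  closure lemmas below use this to replace a derivative by an explicit formula that is valid on
  \<open>U\<close> only.\<close>

lemma ck_on_cong:
  assumes "open U" "\<And>p. p \<in> U \<Longrightarrow> f p = g p" "ck_on k U f"
  shows "ck_on k U g"
  using assms(2,3)
proof (induction k arbitrary: f g)
  case 0
  then show ?case
    using continuous_on_cong[of U U f g] by simp
next
  case (Suc k)
  have d: "(g has_derivative frechet_derivative f (at p)) (at p)" if "p \<in> U" for p
  proof (rule has_derivative_transform_within_open[OF _ \<open>open U\<close> that])
    show "(f has_derivative frechet_derivative f (at p)) (at p)"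
      using Suc.prems(2) that by (simp flip: frechet_derivative_works)
  qed (use Suc.prems in auto)
  have "ck_on k U (\<lambda>p. frechet_derivative g (at p) v)" for v
  proof (rule Suc.IH)
    show "ck_on k U (\<lambda>p. frechet_derivative f (at p) v)"
      using Suc.prems by simp
    show "frechet_derivative f (at p) v = frechet_derivative g (at p) v" if "p \<in> U" for p
      using frechet_derivative_at[OF d[OF that]] by simp
  qed
  then show ?case
    using d unfolding ck_on.simps differentiable_def by blast
qed

lemma smooth_on_cong:
  assumes "open U" "\<And>p. p \<in> U \<Longrightarrow> f p = g p" "smooth_on U f"
  shows "smooth_on U g"
  using assms ck_on_cong unfolding smooth_on_def by blast

lemma smooth_on_const [simp]: "smooth_on U (\<lambda>_. c)"
proof -
  have "ck_on k U (\<lambda>_. c)" for k and c :: 'b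
    by (induction k arbitrary: c) simp_all
  then show ?thesis
    by (simp add: smooth_on_def)
qed

lemma smooth_on_bounded_linear:
  assumes "bounded_linear L" "open U" "smooth_on U f"
  shows "smooth_on U (\<lambda>p. L (f p))"
proof -
  have "ck_on k U (\<lambda>p. L (f p))" if "ck_on k U f" for k
    using that
  proof (induction k arbitrary: f)
    case 0
    then show ?case
      using bounded_linear.continuous_on[OF assms(1)] by simp
  next
    case (Suc k)
    have d: "((\<lambda>p. L (f p)) has_derivative (\<lambda>v. L (frechet_derivative f (at p) v))) (at p)"
      if "p \<in> U" for p
    proof (rule bounded_linear.has_derivative[OF assms(1)])
      show "(f has_derivative frechet_derivative f (at p)) (at p)"
        using Suc.prems that by (simp flip: frechet_derivative_works)
    qed
    have "ck_on k U (\<lambda>p. frechet_derivative (\<lambda>p. L (f p)) (at p) v)" for v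
    proof (rule ck_on_cong[OF assms(2)])
      show "ck_on k U (\<lambda>p. L (frechet_derivative f (at p) v))"
        using Suc by simp
      show "L (frechet_derivative f (at p) v) = frechet_derivative (\<lambda>p. L (f p)) (at p) v"
        if "p \<in> U" for p
        using fun_cong[OF frechet_derivative_at[OF d[OF that]]] by simp
    qed
    then show ?case
      using d unfolding ck_on.simps differentiable_def by blast
  qed
  then show ?thesis
    using assms(3) by (simp add: smooth_on_def)
qed

lemma smooth_on_add:
  assumes "open U" "smooth_on U f" "smooth_on U g"
  shows "smooth_on U (\<lambda>p. f p + g p)"
proof -
  have "ck_on k U (\<lambda>p. f p + g p)" if "ck_on k U f" "ck_on k U g" for k
    using that
  proof (induction k arbitrary: f g)
    case 0
    then show ?case
      by (simp add: continuous_on_add)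
  next
    case (Suc k)
    have d: "((\<lambda>p. f p + g p) has_derivative
        (\<lambda>v. frechet_derivative f (at p) v + frechet_derivative g (at p) v)) (at p)"
      if "p \<in> U" for p
      using Suc.prems that by (intro has_derivative_add) (simp_all flip: frechet_derivative_works)
    have "ck_on k U (\<lambda>p. frechet_derivative (\<lambda>p. f p + g p) (at p) v)" for v
    proof (rule ck_on_cong[OF assms(1)])
      show "ck_on k U (\<lambda>p. frechet_derivative f (at p) v + frechet_derivative g (at p) v)"
        using Suc by simp
      show "frechet_derivative f (at p) v + frechet_derivative g (at p) v =
          frechet_derivative (\<lambda>p. f p + g p) (at p) v" if "p \<in> U" for p
        using fun_cong[OF frechet_derivative_at[OF d[OF that]]] by simp
    qed
    then show ?case
      using d unfolding ck_on.simps differentiable_def by blast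
  qed
  then show ?thesis
    using assms(2,3) by (simp add: smooth_on_def)
qed

text \<open>The derivative in direction \<open>v\<close> is the derivative of \<open>f\<close> along
  \<open>L v\<close>, composed with the same affine map, so the induction closes without products.
  It serves to restrict functions on the box to a line parallel to the \<open>y\<close>
  axis.\<close>

lemma smooth_on_affine:
  fixes L :: "'c::euclidean_space \<Rightarrow> 'a::euclidean_space"
  assumes "bounded_linear L" "open U" "open V" "\<And>y. y \<in> V \<Longrightarrow> a + L y \<in> U" "smooth_on U f"
  shows "smooth_on V (\<lambda>y. f (a + L y))"
proof -
  have A: "((\<lambda>y. a + L y) has_derivative L) (at y)" for y
    using bounded_linear_imp_has_derivative[OF assms(1)] by (auto intro!: derivative_eq_intros)
  have "ck_on k V (\<lambda>y. f (a + L y))" if "ck_on k U f" for k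
    using that
  proof (induction k arbitrary: f)
    case 0
    have "continuous_on V (\<lambda>y. a + L y)"
      using assms(1) by (intro continuous_intros linear_continuous_on)
    then show ?case
      using 0 assms(4) by (auto intro: continuous_on_compose2)
  next
    case (Suc k)
    have d: "((\<lambda>y. f (a + L y)) has_derivative
        (\<lambda>v. frechet_derivative f (at (a + L y)) (L v))) (at y)"
      if "y \<in> V" for y
    proof -
      have "(f has_derivative frechet_derivative f (at (a + L y))) (at (a + L y))"
        using Suc.prems that assms(4) by (simp flip: frechet_derivative_works)
      from diff_chain_at[OF A this] show ?thesis
        by (simp add: o_def)
    qed
    have "ck_on k V (\<lambda>y. frechet_derivative (\<lambda>y. f (a + L y)) (at y) v)" for v
    proof (rule ck_on_cong[OF assms(3)])
      show "ck_on k V (\<lambda>y. frechet_derivative f (at (a + L y)) (L v))"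
        using Suc.IH[of "\<lambda>q. frechet_derivative f (at q) (L v)"] Suc.prems by simp
      show "frechet_derivative f (at (a + L y)) (L v) =
          frechet_derivative (\<lambda>y. f (a + L y)) (at y) v" if "y \<in> V" for y
        using fun_cong[OF frechet_derivative_at[OF d[OF that]]] by simp
    qed
    then show ?case
      using d unfolding ck_on.simps differentiable_def by blast
  qed
  then show ?thesis
    using assms(5) by (simp add: smooth_on_def)
qed

lemma smooth_on_deriv:
  fixes f :: "real \<Rightarrow> real"
  assumes "open K" "smooth_on K f"
  shows "smooth_on K (deriv f)"
proof (rule smooth_on_cong[OF assms(1)])
  show "smooth_on K (\<lambda>y. frechet_derivative f (at y) 1)"
    using smooth_on_frechet_derivative[OF assms(2)] .
  fix y assume "y \<in> K"
  then have f: "(f has_derivative frechet_derivative f (at y)) (at y)"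
    using smooth_on_differentiable[OF assms(2)] by (simp flip: frechet_derivative_works)
  then have "frechet_derivative f (at y) x = frechet_derivative f (at y) 1 * x" for x
    using linear_scale[OF has_derivative_linear, of f "frechet_derivative f (at y)" "at y" x 1]
    by simp
  then have "frechet_derivative f (at y) = (*) (frechet_derivative f (at y) 1)"
    by blast
  then have "(f has_field_derivative frechet_derivative f (at y) 1) (at y)"
    using f by (simp add: has_field_derivative_def)
  then show "frechet_derivative f (at y) 1 = deriv f y"
    by (simp add: DERIV_imp_deriv)
qed

lemma smooth_on_has_deriv:
  fixes f :: "real \<Rightarrow> real"
  assumes "smooth_on K f" "y \<in> K"
  shows "(f has_field_derivative deriv f y) (at y)"
  using smooth_on_differentiable[OF assms]
  by (simp add: DERIV_deriv_iff_real_differentiable)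

section \<open>Symmetry of second derivatives\<close>

lemma second_difference_mean_value:
  fixes F :: "'a::euclidean_space \<Rightarrow> real"
  assumes F: "\<And>q. q \<in> ball p r \<Longrightarrow> F differentiable at q"
    and Fu: "\<And>q. q \<in> ball p r \<Longrightarrow> (\<lambda>q. frechet_derivative F (at q) u) differentiable at q"
    and h: "h > 0" "h * (norm u + norm v) < r"
  shows "\<exists>z\<in>ball p r. F (p + h *\<^sub>R u + h *\<^sub>R v) - F (p + h *\<^sub>R u) - F (p + h *\<^sub>R v) + F p =
     h\<^sup>2 * frechet_derivative (\<lambda>q. frechet_derivative F (at q) u) (at z) v"
proof -
  have mem: "p + s *\<^sub>R u + t *\<^sub>R v \<in> ball p r" if "0 \<le> s" "s \<le> h" "0 \<le> t" "t \<le> h" for s t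
  proof -
    have "norm (s *\<^sub>R u + t *\<^sub>R v) \<le> s * norm u + t * norm v"
      using that norm_triangle_ineq[of "s *\<^sub>R u" "t *\<^sub>R v"] by simp
    also have "\<dots> \<le> h * norm u + h * norm v"
      using that by (intro add_mono mult_right_mono) auto
    also have "\<dots> < r"
      using h by (simp add: algebra_simps)
    finally show ?thesis
      by (metis add.assoc add_diff_cancel_left' dist_commute dist_norm mem_ball)
  qed
  have line: "((\<lambda>s. G (a + s *\<^sub>R w)) has_real_derivative frechet_derivative G (at (a + s *\<^sub>R w)) w) (at s)"
    if "G differentiable at (a + s *\<^sub>R w)" for G :: "'a \<Rightarrow> real" and a w s
  proof -
    have G: "(G has_derivative frechet_derivative G (at (a + s *\<^sub>R w))) (at (a + s *\<^sub>R w))"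
      using that by (simp flip: frechet_derivative_works)
    have "((\<lambda>s. a + s *\<^sub>R w) has_derivative (\<lambda>x. x *\<^sub>R w)) (at s)"
      by (auto intro!: derivative_eq_intros)
    from diff_chain_at[OF this G] show ?thesis
      using linear_scale[OF has_derivative_linear[OF G]]
      by (simp add: has_field_derivative_def o_def mult_commute_abs)
  qed
  \<comment> \<open>The second difference is the increment of \<open>g\<close>. The mean value
    theorem in direction \<open>u\<close> turns it into a difference of \<open>u\<close>-derivatives
    at two points that differ by \<open>h *\<^sub>R v\<close>; a second use, in direction
    \<open>v\<close>, produces the mixed derivative.\<close>
  define g where "g = (\<lambda>s. F ((p + h *\<^sub>R v) + s *\<^sub>R u) - F (p + s *\<^sub>R u))"
  let ?Fu = "\<lambda>q. frechet_derivative F (at q) u"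
  have "(g has_real_derivative ?Fu ((p + h *\<^sub>R v) + s *\<^sub>R u) - ?Fu (p + s *\<^sub>R u)) (at s)"
    if "0 \<le> s" "s \<le> h" for s
    unfolding g_def
  proof (intro DERIV_diff line F)
    show "p + h *\<^sub>R v + s *\<^sub>R u \<in> ball p r"
      using mem[of s h] that h by (simp only: add.assoc add.commute[of "h *\<^sub>R v"])
    show "p + s *\<^sub>R u \<in> ball p r"
      using mem[of s 0] that h by simp
  qed
  then obtain s where s: "0 < s" "s < h"
    and gs: "g h - g 0 = (h - 0) * (?Fu ((p + h *\<^sub>R v) + s *\<^sub>R u) - ?Fu (p + s *\<^sub>R u))"
    using MVT2[OF h(1), of g "\<lambda>s. ?Fu ((p + h *\<^sub>R v) + s *\<^sub>R u) - ?Fu (p + s *\<^sub>R u)"]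
    by blast
  have "((\<lambda>t. ?Fu ((p + s *\<^sub>R u) + t *\<^sub>R v)) has_real_derivative
      frechet_derivative ?Fu (at ((p + s *\<^sub>R u) + t *\<^sub>R v)) v) (at t)" if "0 \<le> t" "t \<le> h" for t
    using mem[of s t] that s by (intro line Fu) simp
  then obtain t where t: "0 < t" "t < h"
    and gt: "?Fu ((p + s *\<^sub>R u) + h *\<^sub>R v) - ?Fu ((p + s *\<^sub>R u) + 0 *\<^sub>R v) =
      (h - 0) * frechet_derivative ?Fu (at ((p + s *\<^sub>R u) + t *\<^sub>R v)) v"
    using MVT2[OF h(1), of "\<lambda>t. ?Fu ((p + s *\<^sub>R u) + t *\<^sub>R v)"
        "\<lambda>t. frechet_derivative ?Fu (at ((p + s *\<^sub>R u) + t *\<^sub>R v)) v"] by blast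
  have "g h - g 0 = h\<^sup>2 * frechet_derivative ?Fu (at ((p + s *\<^sub>R u) + t *\<^sub>R v)) v"
    using gs gt by (simp add: power2_eq_square add.commute add.left_commute)
  moreover have "g h - g 0 = F (p + h *\<^sub>R u + h *\<^sub>R v) - F (p + h *\<^sub>R u) - F (p + h *\<^sub>R v) + F p"
    by (simp add: g_def algebra_simps)
  ultimately show ?thesis
    using mem[of s t] s t by force
qed

text \<open>The second difference is unchanged when \<open>u\<close> and \<open>v\<close> are
  exchanged, so the two mixed derivatives agree at suitable points \<open>z\<close> and
  \<open>z'\<close> close to \<open>p\<close>; continuity then excludes a gap at
  \<open>p\<close>.\<close>

lemma symmetric_frechet_derivative:
  fixes F :: "'a::euclidean_space \<Rightarrow> real"
  assumes "open U" "smooth_on U F" "p \<in> U"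
  shows "frechet_derivative (\<lambda>q. frechet_derivative F (at q) u) (at p) v =
    frechet_derivative (\<lambda>q. frechet_derivative F (at q) v) (at p) u" (is "?A u v p = ?A v u p")
proof (rule ccontr)
  assume ne: "?A u v p \<noteq> ?A v u p"
  \<comment> \<open>Half of the supposed gap: two errors below \<open>e\<close> cannot bridge
    it.\<close>
  define e where "e = \<bar>?A u v p - ?A v u p\<bar> / 2"
  have e: "e > 0"
    using ne by (simp add: e_def)
  have cont: "continuous_on U (?A w w')" for w w'
    by (intro smooth_on_imp_continuous_on smooth_on_frechet_derivative assms(2))
  obtain r0 where r0: "r0 > 0" "ball p r0 \<subseteq> U"
    using assms(1,3) openE by blast
  have "\<exists>r>0. \<forall>q. dist q p < r \<longrightarrow> \<bar>?A w w' q - ?A w w' p\<bar> < e" for w w'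
    using cont[of w w'] assms(1,3) e
    unfolding continuous_on_eq_continuous_at[OF assms(1)] continuous_at_eps_delta dist_real_def
    by blast
  then obtain r1 r2 where r1: "r1 > 0" "\<And>q. dist q p < r1 \<Longrightarrow> \<bar>?A u v q - ?A u v p\<bar> < e"
    and r2: "r2 > 0" "\<And>q. dist q p < r2 \<Longrightarrow> \<bar>?A v u q - ?A v u p\<bar> < e"
    by metis
  define r where "r = min r0 (min r1 r2)"
  have r: "r > 0"
    using r0 r1 r2 by (simp add: r_def)
  \<comment> \<open>The summand \<open>1\<close> keeps the denominator positive when
    \<open>u\<close> and \<open>v\<close> vanish and makes the bound below strict.\<close>
  define h where "h = r / (norm u + norm v + 1)"
  have n: "0 \<le> norm u + norm v"
    by simp
  then have h0: "h > 0"
    using r by (simp add: h_def add_nonneg_pos)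
  have h: "h * (norm u + norm v) < r"
    using r add_nonneg_pos[OF n zero_less_one] by (simp add: h_def pos_divide_less_eq)
  then have h': "h * (norm v + norm u) < r"
    by (simp add: add.commute)
  have sub: "q \<in> U" if "q \<in> ball p r" for q
    using that r0 by (auto simp: r_def)
  have Fd: "F differentiable at q" "(\<lambda>q. frechet_derivative F (at q) w) differentiable at q"
    if "q \<in> ball p r" for q w
    using sub[OF that] smooth_on_differentiable assms(2) smooth_on_frechet_derivative by blast+
  obtain z where z: "z \<in> ball p r"
    "F (p + h *\<^sub>R u + h *\<^sub>R v) - F (p + h *\<^sub>R u) - F (p + h *\<^sub>R v) + F p = h\<^sup>2 * ?A u v z"
    using second_difference_mean_value[OF Fd h0 h] by blast
  obtain z' where z': "z' \<in> ball p r"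
    "F (p + h *\<^sub>R v + h *\<^sub>R u) - F (p + h *\<^sub>R v) - F (p + h *\<^sub>R u) + F p = h\<^sup>2 * ?A v u z'"
    using second_difference_mean_value[OF Fd h0 h'] by blast
  have "h\<^sup>2 * ?A u v z = h\<^sup>2 * ?A v u z'"
    using z(2) z'(2) by (simp add: algebra_simps)
  then have "?A u v z = ?A v u z'"
    using h0 by simp
  moreover have "\<bar>?A u v z - ?A u v p\<bar> < e" "\<bar>?A v u z' - ?A v u p\<bar> < e"
    using r1(2)[of z] r2(2)[of z'] z(1) z'(1) by (auto simp: r_def dist_commute)
  ultimately show False
    unfolding e_def by argo
qed

section \<open>First and second derivatives in coordinates\<close>

definition pd :: "'n \<Rightarrow> (real^'n \<Rightarrow> 'b::real_normed_vector) \<Rightarrow> real^'n \<Rightarrow> 'b" where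
  "pd i F p = frechet_derivative F (at p) (axis i 1)"

lemma has_derivative_frechet:
  "f differentiable at p \<Longrightarrow> (f has_derivative frechet_derivative f (at p)) (at p)"
  by (simp flip: frechet_derivative_works)

lemma pd_eqI: "(F has_derivative F') (at p) \<Longrightarrow> pd i F p = F' (axis i 1)"
  using frechet_derivative_at[of F F' p] by (simp add: pd_def)

lemma smooth_on_pd: "smooth_on U F \<Longrightarrow> smooth_on U (pd i F)"
  unfolding pd_def by (rule smooth_on_frechet_derivative)

lemma has_derivative_expand:
  fixes F :: "real^'n \<Rightarrow> 'b::real_normed_vector"
  assumes "(F has_derivative F') (at p)"
  shows "F' v = (\<Sum>i\<in>UNIV. v $ i *\<^sub>R pd i F p)"
proof -
  have l: "linear F'"
    using assms has_derivative_linear by blast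
  have "F' v = F' (\<Sum>i\<in>UNIV. v $ i *\<^sub>R axis i 1)"
    by (simp add: basis_expansion flip: scalar_mult_eq_scaleR)
  then show ?thesis
    by (simp add: linear_sum[OF l] linear_scale[OF l] pd_eqI[OF assms])
qed

lemma pd_cong:
  assumes "open U" "\<And>q. q \<in> U \<Longrightarrow> F q = G q" "G differentiable at p" "p \<in> U"
  shows "pd i F p = pd i G p"
  using frechet_derivative_transform_within_open[OF assms(3,1,4), of F] assms(2)
  by (simp add: pd_def)

lemma has_derivative_vec_nth:
  "(F has_derivative F') (at p) \<Longrightarrow> ((\<lambda>q. F q $ i) has_derivative (\<lambda>v. F' v $ i)) (at p)"
  by (rule bounded_linear.has_derivative[OF bounded_linear_vec_nth])

lemma pd_vec_nth: "F differentiable at p \<Longrightarrow> pd i (\<lambda>q. F q $ j) p = pd i F p $ j"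
  unfolding pd_def[of i F] by (rule pd_eqI[OF has_derivative_vec_nth[OF has_derivative_frechet]])

lemma smooth_on_vec_nth: "open U \<Longrightarrow> smooth_on U F \<Longrightarrow> smooth_on U (\<lambda>p. F p $ j)"
  by (rule smooth_on_bounded_linear[OF bounded_linear_vec_nth])

lemma pd_commute:
  fixes F :: "real^'n \<Rightarrow> real"
  assumes "open U" "smooth_on U F" "p \<in> U"
  shows "pd i (pd j F) p = pd j (pd i F) p"
  unfolding pd_def using symmetric_frechet_derivative[OF assms] .

text \<open>The second derivative as a bilinear map. It is assembled from partial derivatives
  because \<open>smooth_on\<close> speaks of derivatives in fixed directions.\<close>

definition hess :: "(real^'n \<Rightarrow> real^'m) \<Rightarrow> real^'n \<Rightarrow> real^'n \<Rightarrow> real^'n \<Rightarrow> real^'m" where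
  "hess F p u v = (\<Sum>i\<in>UNIV. \<Sum>j\<in>UNIV. (u $ i * v $ j) *\<^sub>R pd i (pd j F) p)"

lemma hess_nth:
  fixes F :: "real^'n \<Rightarrow> real^'m"
  assumes "open U" "smooth_on U F" "p \<in> U"
  shows "hess F p u v $ k = (\<Sum>i\<in>UNIV. \<Sum>j\<in>UNIV. u $ i * v $ j * pd i (pd j (\<lambda>q. F q $ k)) p)"
proof -
  have d: "F differentiable at q" "pd j F differentiable at q" if "q \<in> U" for q j
    using that assms smooth_on_pd smooth_on_differentiable by blast+
  have "pd i (pd j (\<lambda>q. F q $ k)) p = pd i (pd j F) p $ k" for i j
  proof -
    have "pd i (pd j (\<lambda>q. F q $ k)) p = pd i (\<lambda>q. pd j F q $ k) p"
      by (rule pd_cong[OF assms(1) pd_vec_nth[OF d(1)] _ assms(3)])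
        (use has_derivative_vec_nth[OF has_derivative_frechet[OF d(2)[OF assms(3)]]]
          in \<open>auto simp: differentiable_def\<close>)
    then show ?thesis
      using pd_vec_nth[OF d(2)[OF assms(3)]] by simp
  qed
  then show ?thesis
    by (simp add: hess_def)
qed

lemma hess_commute:
  fixes F :: "real^'n \<Rightarrow> real^'m"
  assumes "open U" "smooth_on U F" "p \<in> U"
  shows "hess F p u v = hess F p v u"
proof (rule vec_eq_iff[THEN iffD2], rule allI)
  fix k
  have "pd i (pd j (\<lambda>q. F q $ k)) p = pd j (pd i (\<lambda>q. F q $ k)) p" for i j
    by (rule pd_commute[OF assms(1) smooth_on_vec_nth[OF assms(1,2)] assms(3)])
  then show "hess F p u v $ k = hess F p v u $ k"
    unfolding hess_nth[OF assms] by (subst sum.swap) (simp add: mult.commute)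
qed

text \<open>The direction \<open>Y q\<close> moves with the point. Expansion in the coordinate
  directions gives products of a component of \<open>Y\<close> and a partial derivative of
  \<open>F\<close>; the product rule then yields one term with \<open>Y'\<close> and one with the
  Hessian.\<close>

lemma has_derivative_frechet_apply:
  fixes F :: "real^'n \<Rightarrow> real^'m" and Y :: "real^'n \<Rightarrow> real^'n"
  assumes "open U" "smooth_on U F" "p \<in> U" "(Y has_derivative Y') (at p)"
  shows "((\<lambda>q. frechet_derivative F (at q) (Y q)) has_derivative
    (\<lambda>u. frechet_derivative F (at p) (Y' u) + hess F p u (Y p))) (at p)"
proof (rule has_derivative_transform_within_open[OF _ assms(1,3)])
  have exp: "frechet_derivative F (at q) v = (\<Sum>j\<in>UNIV. v $ j *\<^sub>R pd j F q)" if "q \<in> U" for q v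
    using has_derivative_expand[OF has_derivative_frechet] smooth_on_differentiable[OF assms(2) that]
    by blast
  then show "(\<Sum>j\<in>UNIV. Y q $ j *\<^sub>R pd j F q) = frechet_derivative F (at q) (Y q)" if "q \<in> U" for q
    using that by simp
  have pd: "(pd j F has_derivative frechet_derivative (pd j F) (at p)) (at p)" for j
    using has_derivative_frechet smooth_on_differentiable smooth_on_pd assms(2,3) by blast
  have "frechet_derivative (pd j F) (at p) u = (\<Sum>i\<in>UNIV. u $ i *\<^sub>R pd i (pd j F) p)" for j u
    using has_derivative_expand[OF pd] .
  then have eq: "frechet_derivative F (at p) (Y' u) + hess F p u (Y p) =
      (\<Sum>j\<in>UNIV. Y p $ j *\<^sub>R frechet_derivative (pd j F) (at p) u + Y' u $ j *\<^sub>R pd j F p)" for u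
    unfolding hess_def
    by (subst sum.swap) (simp add: exp[OF assms(3)] sum.distrib scaleR_sum_right mult.commute)
  show "((\<lambda>q. \<Sum>j\<in>UNIV. Y q $ j *\<^sub>R pd j F q) has_derivative
      (\<lambda>u. frechet_derivative F (at p) (Y' u) + hess F p u (Y p))) (at p)"
    unfolding eq
    by (intro has_derivative_sum has_derivative_scaleR pd has_derivative_vec_nth assms(4))
qed

subsection \<open>The connection and curvature of the metric\<close>

text \<open>The constant part of the Christoffel symbols. With \<open>f\<close> the coefficient of
  \<open>dy^2\<close>, the only nonzero ones are \<open>f_x / 2\<close> (upper index
  \<open>t\<close>, lower indices \<open>x\<close>, \<open>y\<close>) and \<open>- f_x / 2\<close>
  (upper \<open>x\<close>, lower \<open>y\<close>, \<open>y\<close>), where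
  \<open>f_x / 2 = - exp (b * x) / b\<close>. This factor is split off in
  \<open>walker_gamma\<close>.\<close>

definition walker_bil :: "real^3 \<Rightarrow> real^3 \<Rightarrow> real^3" where
  "walker_bil u v = vector [u $ 2 * v $ 3 + u $ 3 * v $ 2, - (u $ 3 * v $ 3), 0]"

definition walker_gamma :: "real \<Rightarrow> real^3 \<Rightarrow> real^3 \<Rightarrow> real^3 \<Rightarrow> real^3" where
  "walker_gamma b p u v = (- exp (b * p $ 2) / b) *\<^sub>R walker_bil u v"

lemma bounded_bilinear_walker_bil: "bounded_bilinear walker_bil"
  unfolding bilinear_conv_bounded_bilinear[symmetric]
  by (auto simp: bilinear_def linear_iff walker_bil_def vec_eq_iff forall_3 algebra_simps)

lemma walker_gamma_diff_left: "walker_gamma b p (u - v) w = walker_gamma b p u w - walker_gamma b p v w"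
  and walker_gamma_diff_right: "walker_gamma b p w (u - v) = walker_gamma b p w u - walker_gamma b p w v"
  and walker_gamma_zero [simp]: "walker_gamma b p 0 w = 0" "walker_gamma b p w 0 = 0"
  by (simp_all add: walker_gamma_def algebra_simps
      bounded_bilinear.diff_left[OF bounded_bilinear_walker_bil]
      bounded_bilinear.diff_right[OF bounded_bilinear_walker_bil]
      bounded_bilinear.zero_left[OF bounded_bilinear_walker_bil]
      bounded_bilinear.zero_right[OF bounded_bilinear_walker_bil])

lemma has_derivative_exp_coord:
  fixes p :: "real^'n"
  shows "((\<lambda>q. exp (b * q $ i)) has_derivative (\<lambda>u. b * u $ i * exp (b * p $ i))) (at p)"
  by (rule DERIV_compose_FDERIV[OF DERIV_exp
        has_derivative_mult_right[OF has_derivative_vec_nth[OF has_derivative_ident]]])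

lemma has_derivative_walker_gamma:
  assumes "(Y has_derivative Y') (at p)" "(Z has_derivative Z') (at p)"
  shows "((\<lambda>q. walker_gamma b q (Y q) (Z q)) has_derivative
    (\<lambda>u. (b * u $ 2) *\<^sub>R walker_gamma b p (Y p) (Z p) + walker_gamma b p (Y' u) (Z p)
      + walker_gamma b p (Y p) (Z' u))) (at p)"
proof -
  have "((\<lambda>q. - (1 / b) * exp (b * q $ 2)) has_derivative
      (\<lambda>u. - (1 / b) * (b * u $ 2 * exp (b * p $ 2)))) (at p)"
    by (intro has_derivative_mult_right has_derivative_exp_coord)
  note has_derivative_scaleR[OF this bounded_bilinear.FDERIV[OF bounded_bilinear_walker_bil assms]]
  then show ?thesis
    by (simp add: walker_gamma_def algebra_simps)
qed

text \<open>\<open>matrix_inv\<close> chooses some two-sided inverse, and two-sided inverses are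
  unique.\<close>

lemma matrix_inv_eqI:
  fixes A B :: "'a::semiring_1^'n^'n"
  assumes "A ** B = mat 1" "B ** A = mat 1"
  shows "matrix_inv A = B"
proof -
  have "A ** matrix_inv A = mat 1 \<and> matrix_inv A ** A = mat 1"
    unfolding matrix_inv_def by (rule someI) (use assms in blast)
  then show ?thesis
    by (metis assms(2) matrix_mul_assoc matrix_mul_lid matrix_mul_rid)
qed

lemma matrix_inv_walker_metric:
  "matrix_inv (metric_matrix (walker_metric f) p) =
    vector [vector [- f (p $ 2) (p $ 3), 0, 1], vector [0, 1, 0], vector [1, 0, 0]]"
  by (rule matrix_inv_eqI)
    (simp_all add: vec_eq_iff forall_3 matrix_matrix_mult_def sum_3 metric_matrix_def
      walker_metric_def axis_def mat_def)

lemma metric_partial_walker_N: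
  assumes "b \<noteq> 0"
  shows "metric_partial (walker_N b) p k i j =
    (if k = 2 \<and> i = 3 \<and> j = 3 then - 2 * exp (b * p $ 2) / b else 0)"
proof -
  define c where "c = (axis i 1 :: real^3) $ 1 * (axis j 1 :: real^3) $ 3
     + (axis i 1 :: real^3) $ 3 * (axis j 1 :: real^3) $ 1 + (axis i 1 :: real^3) $ 2 * (axis j 1 :: real^3) $ 2"
  define d where "d = - 2 / b\<^sup>2 * ((axis i 1 :: real^3) $ 3 * (axis j 1 :: real^3) $ 3)"
  have eq: "(\<lambda>q. metric_matrix (walker_N b) q $ i $ j) = (\<lambda>q. c + d * exp (b * q $ 2))"
    by (simp add: fun_eq_iff metric_matrix_def walker_N_def walker_metric_def c_def d_def)
  have "((\<lambda>q. c + d * exp (b * q $ 2)) has_derivative (\<lambda>u. d * (b * u $ 2 * exp (b * p $ 2)))) (at p)"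
    using has_derivative_add[OF has_derivative_const has_derivative_mult_right[OF has_derivative_exp_coord]]
    by simp
  then have "frechet_derivative (\<lambda>q. metric_matrix (walker_N b) q $ i $ j) (at p) =
      (\<lambda>u. d * (b * u $ 2 * exp (b * p $ 2)))"
    unfolding eq by (rule frechet_derivative_at[symmetric])
  then have "metric_partial (walker_N b) p k i j = d * (b * axis k 1 $ 2 * exp (b * p $ 2))"
    by (simp add: metric_partial_def)
  also have "\<dots> = (if k = 2 \<and> i = 3 \<and> j = 3 then - 2 * exp (b * p $ 2) / b else 0)"
    using assms by (auto simp: d_def axis_def power2_eq_square)
  finally show ?thesis .
qed

lemma levi_civita_walker_N:
  assumes "b \<noteq> 0"
  shows "levi_civita (walker_N b) Y Z p =
    frechet_derivative Z (at p) (Y p) + walker_gamma b p (Y p) (Z p)"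
proof -
  have "christoffel (walker_N b) p k i j = (- exp (b * p $ 2) / b) *
     (if k = 1 \<and> (i = 2 \<and> j = 3 \<or> i = 3 \<and> j = 2) then 1 else if k = 2 \<and> i = 3 \<and> j = 3 then -1 else 0)" for k i j
    unfolding christoffel_def metric_partial_walker_N[OF assms]
    unfolding walker_N_def matrix_inv_walker_metric
    using exhaust_3[of k] exhaust_3[of i] exhaust_3[of j] by (auto simp: sum_3)
  then have "(\<chi> k. \<Sum>i\<in>UNIV. \<Sum>j\<in>UNIV. christoffel (walker_N b) p k i j * Y p $ i * Z p $ j)
      = walker_gamma b p (Y p) (Z p)"
    by (simp add: vec_eq_iff forall_3 sum_3 walker_gamma_def walker_bil_def algebra_simps
        add_divide_distrib)
  then show ?thesis
    by (simp add: levi_civita_def)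
qed

text \<open>The curvature without its exponential factor: the 2-form \<open>dx \<and> dy\<close>
  times a nilpotent endomorphism, which sends the \<open>y\<close> field to the \<open>x\<close>
  field, the \<open>x\<close> field to minus the \<open>t\<close> field, and the \<open>t\<close>
  field to zero.\<close>

definition walker_curv :: "real^3 \<Rightarrow> real^3 \<Rightarrow> real^3 \<Rightarrow> real^3" where
  "walker_curv u v w = (u $ 2 * v $ 3 - u $ 3 * v $ 2) *\<^sub>R vector [- w $ 2, w $ 3, 0]"

lemma walker_curv_diff:
  "walker_curv (u - u') v w = walker_curv u v w - walker_curv u' v w"
  "walker_curv u (v - v') w = walker_curv u v w - walker_curv u v' w"
  "walker_curv u v (w - w') = walker_curv u v w - walker_curv u v w'"
  by (simp_all add: walker_curv_def vec_eq_iff forall_3 algebra_simps)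

text \<open>The quadratic term \<open>walker_gamma b p u (walker_gamma b p v w)\<close> is symmetric
  in \<open>u\<close> and \<open>v\<close> and cancels. Only the derivatives of the exponential in
  the connection survive, so the curvature contains the first power of \<open>exp (b * x)\<close>
  and no square.\<close>

lemma curvature_tensor_walker_N:
  assumes "b \<noteq> 0"
  shows "curvature_tensor (walker_N b) p u v w = exp (b * p $ 2) *\<^sub>R walker_curv u v w"
proof -
  have d: "frechet_derivative (\<lambda>q. walker_gamma b q v w) (at p) u = (b * u $ 2) *\<^sub>R walker_gamma b p v w" for u v
    using fun_cong[OF frechet_derivative_at[OF has_derivative_walker_gamma[OF has_derivative_const has_derivative_const]]]
    by simp
  have l: "levi_civita (walker_N b) (\<lambda>_. u) (\<lambda>_. w) = (\<lambda>q. walker_gamma b q u w)" for u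
    by (simp add: levi_civita_walker_N[OF assms] fun_eq_iff)
  show ?thesis
    unfolding curvature_tensor_def curvature_op_def l lie_bracket_def
    unfolding levi_civita_walker_N[OF assms] d
    using assms
    by (simp add: walker_gamma_def walker_curv_def walker_bil_def
        vec_eq_iff forall_3 divide_simps algebra_simps)
qed

text \<open>In the trace the index \<open>1\<close> meets no \<open>dx \<and> dy\<close>, and the
  index \<open>3\<close> meets the vanishing third component of the curvature; the index
  \<open>2\<close> alone contributes.\<close>

lemma ricci_walker_N:
  assumes "b \<noteq> 0"
  shows "ricci (walker_N b) p v w = exp (b * p $ 2) * v $ 3 * w $ 3"
  by (simp add: ricci_def curvature_tensor_walker_N[OF assms] walker_curv_def sum_3 axis_def)

subsection \<open>Lie derivatives\<close>

lemma lie_bracket_eq: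
  assumes "(X has_derivative X') (at p)" "(Y has_derivative Y') (at p)"
  shows "lie_bracket X Y p = Y' (X p) - X' (Y p)"
  unfolding lie_bracket_def using frechet_derivative_at assms by metis

text \<open>The derivatives of \<open>Y\<close> and \<open>Z\<close> along \<open>X\<close> cancel
  between the product rule and the brackets. The result involves these fields only through their
  values at \<open>p\<close>, which later permits constant fields as test fields.\<close>

lemma lie_deriv_form_walker_N:
  assumes b: "b \<noteq> 0" and X: "(X has_derivative X') (at p)"
    and "(Y has_derivative Y') (at p)" "(Z has_derivative Z') (at p)"
  shows "lie_deriv_form X (walker_N b) Y Z p =
    - 2 * exp (b * p $ 2) / b * X p $ 2 * Y p $ 3 * Z p $ 3
      + walker_N b p (X' (Y p)) (Z p) + walker_N b p (Y p) (X' (Z p))"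
proof -
  note nth = has_derivative_vec_nth[OF assms(3)] has_derivative_vec_nth[OF assms(4)]
  have "((\<lambda>q. walker_N b q (Y q) (Z q)) has_derivative
     (\<lambda>u. - 2 / b\<^sup>2 * (b * u $ 2 * exp (b * p $ 2)) * Y p $ 3 * Z p $ 3
       + walker_N b p (Y' u) (Z p) + walker_N b p (Y p) (Z' u))) (at p)"
    (is "(_ has_derivative ?D) _")
  proof -
    have "(\<lambda>q. walker_N b q (Y q) (Z q)) = (\<lambda>q. Y q $ 1 * Z q $ 3 + Y q $ 3 * Z q $ 1
        + Y q $ 2 * Z q $ 2 + (- 2 / b\<^sup>2 * exp (b * q $ 2)) * Y q $ 3 * Z q $ 3)"
      by (simp add: walker_N_def walker_metric_def)
    moreover have "(\<dots> has_derivative ?D) (at p)"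
      by (rule has_derivative_eq_rhs, (rule has_derivative_add has_derivative_mult
          has_derivative_exp_coord has_derivative_const nth)+)
        (simp add: fun_eq_iff walker_N_def walker_metric_def algebra_simps)
    ultimately show ?thesis
      by simp
  qed
  note d = this[THEN frechet_derivative_at, symmetric]
  show ?thesis
    unfolding lie_deriv_form_def d lie_bracket_eq[OF X assms(3)] lie_bracket_eq[OF X assms(4)]
    using b by (simp add: walker_N_def walker_metric_def field_simps power2_eq_square)
qed

lemma lie_deriv_form_ricci_walker_N:
  assumes "b \<noteq> 0"
    and "(X has_derivative X') (at p)" "(Y has_derivative Y') (at p)" "(Z has_derivative Z') (at p)"
  shows "lie_deriv_form X (ricci (walker_N b)) Y Z p =
    exp (b * p $ 2) * (b * X p $ 2 * Y p $ 3 * Z p $ 3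
      + X' (Y p) $ 3 * Z p $ 3 + Y p $ 3 * X' (Z p) $ 3)"
proof -
  note nth = has_derivative_vec_nth[OF assms(3)] has_derivative_vec_nth[OF assms(4)]
  have "((\<lambda>q. exp (b * q $ 2) * Y q $ 3 * Z q $ 3) has_derivative
     (\<lambda>u. exp (b * p $ 2) * (b * u $ 2 * Y p $ 3 * Z p $ 3 + Y' u $ 3 * Z p $ 3 + Y p $ 3 * Z' u $ 3))) (at p)"
    by (rule has_derivative_eq_rhs, (rule has_derivative_mult has_derivative_exp_coord nth)+)
      (simp add: fun_eq_iff algebra_simps)
  note d = this[THEN frechet_derivative_at, symmetric]
  show ?thesis
    unfolding lie_deriv_form_def ricci_walker_N[OF assms(1)] d
      lie_bracket_eq[OF assms(2,3)] lie_bracket_eq[OF assms(2,4)]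
    by (simp add: algebra_simps)
qed

lemma lie_deriv_curvature_walker_N:
  assumes "b \<noteq> 0" and X: "(X has_derivative X') (at p)"
    and Y: "(Y has_derivative Y') (at p)" and Z: "(Z has_derivative Z') (at p)"
    and W: "(W has_derivative W') (at p)"
  shows "lie_deriv_tensor13 X (curvature_tensor (walker_N b)) Y Z W p =
    exp (b * p $ 2) *\<^sub>R ((b * X p $ 2) *\<^sub>R walker_curv (Y p) (Z p) (W p)
      - X' (walker_curv (Y p) (Z p) (W p)) + walker_curv (X' (Y p)) (Z p) (W p)
      + walker_curv (Y p) (X' (Z p)) (W p) + walker_curv (Y p) (Z p) (X' (W p)))"
proof -
  let ?A = "\<lambda>w::real^3. vector [- w $ 2, w $ 3, 0] :: real^3"
  have "linear ?A"
    by (auto simp: linear_iff vec_eq_iff forall_3)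
  then have A: "((\<lambda>q. ?A (W q)) has_derivative (\<lambda>u. ?A (W' u))) (at p)"
    using bounded_linear.has_derivative[OF _ W] linear_linear by blast
  have E: "((\<lambda>q. exp (b * q $ 2) * (Y q $ 2 * Z q $ 3 - Y q $ 3 * Z q $ 2)) has_derivative
      (\<lambda>u. exp (b * p $ 2) * (b * u $ 2 * (Y p $ 2 * Z p $ 3 - Y p $ 3 * Z p $ 2)
        + (Y' u $ 2 * Z p $ 3 - Y' u $ 3 * Z p $ 2) + (Y p $ 2 * Z' u $ 3 - Y p $ 3 * Z' u $ 2)))) (at p)"
    by (rule has_derivative_eq_rhs, (rule has_derivative_mult has_derivative_diff
        has_derivative_exp_coord has_derivative_vec_nth[OF Y] has_derivative_vec_nth[OF Z])+)
      (simp add: fun_eq_iff algebra_simps)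
  from has_derivative_scaleR[OF E A]
  have "((\<lambda>q. exp (b * q $ 2) *\<^sub>R walker_curv (Y q) (Z q) (W q)) has_derivative
     (\<lambda>u. exp (b * p $ 2) *\<^sub>R ((b * u $ 2) *\<^sub>R walker_curv (Y p) (Z p) (W p)
      + walker_curv (Y' u) (Z p) (W p)
      + walker_curv (Y p) (Z' u) (W p) + walker_curv (Y p) (Z p) (W' u)))) (at p)"
    by (simp add: walker_curv_def algebra_simps)
  note d = lie_bracket_eq[OF X this]
  have "linear X'"
    using X has_derivative_linear by blast
  then show ?thesis
    unfolding lie_deriv_tensor13_def curvature_tensor_walker_N[OF assms(1)] d
      lie_bracket_eq[OF X Y] lie_bracket_eq[OF X Z] lie_bracket_eq[OF X W]
    by (simp add: linear_scale walker_curv_diff algebra_simps)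
qed

text \<open>A connection is not tensorial, and second derivatives of \<open>Z\<close> enter twice:
  from differentiating the covariant derivative along \<open>X\<close>, and from differentiating
  \<open>lie_bracket X Z\<close> along \<open>Y\<close>. They cancel by symmetry of the Hessian. The
  Hessian of \<open>X\<close> is what makes the affine system second order.\<close>

lemma lie_deriv_levi_civita_walker_N:
  assumes b: "b \<noteq> 0" and U: "open U" "p \<in> U"
    and X: "smooth_on U X" and Y: "smooth_on U Y" and Z: "smooth_on U Z"
  defines "X' \<equiv> frechet_derivative X (at p)"
  shows "lie_deriv_connection X (levi_civita (walker_N b)) Y Z p =
    (b * X p $ 2) *\<^sub>R walker_gamma b p (Y p) (Z p) - X' (walker_gamma b p (Y p) (Z p))
      + walker_gamma b p (X' (Y p)) (Z p) + walker_gamma b p (Y p) (X' (Z p)) + hess X p (Y p) (Z p)"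
proof -
  define Y' where "Y' = frechet_derivative Y (at p)"
  define Z' where "Z' = frechet_derivative Z (at p)"
  have d: "(X has_derivative X') (at p)" "(Y has_derivative Y') (at p)" "(Z has_derivative Z') (at p)"
    unfolding X'_def Y'_def Z'_def
    using has_derivative_frechet smooth_on_differentiable U X Y Z by blast+
  have l: "linear X'" "linear Y'" "linear Z'"
    using d has_derivative_linear by blast+
  have 1: "lie_bracket X (levi_civita (walker_N b) Y Z) p =
     Z' (Y' (X p)) + hess Z p (X p) (Y p) + ((b * X p $ 2) *\<^sub>R walker_gamma b p (Y p) (Z p)
      + walker_gamma b p (Y' (X p)) (Z p) + walker_gamma b p (Y p) (Z' (X p)))
      - X' (Z' (Y p) + walker_gamma b p (Y p) (Z p))"
    unfolding levi_civita_walker_N[OF b] Z'_def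
    by (subst lie_bracket_eq[OF d(1) has_derivative_add[OF
         has_derivative_frechet_apply[OF U(1) Z U(2) d(2)] has_derivative_walker_gamma[OF d(2,3)]]])
      (simp add: Z'_def)
  have 2: "(lie_bracket X Z has_derivative
     (\<lambda>u. (Z' (X' u) + hess Z p u (X p)) - (X' (Z' u) + hess X p u (Z p)))) (at p)"
    unfolding lie_bracket_def[abs_def] Z'_def X'_def
    using has_derivative_diff[OF has_derivative_frechet_apply[OF U(1) Z U(2) d(1)]
      has_derivative_frechet_apply[OF U(1) X U(2) d(3)]] by (simp add: X'_def Z'_def)
  show ?thesis
    unfolding lie_deriv_connection_def 1
    unfolding levi_civita_walker_N[OF b] frechet_derivative_at[OF 2, symmetric]
      lie_bracket_eq[OF d(1,2)] lie_bracket_eq[OF d(1,3)] Z'_def[symmetric]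
    using hess_commute[OF U(1) Z U(2), of "X p" "Y p"] l
    by (simp add: linear_diff linear_add walker_gamma_diff_left walker_gamma_diff_right)
qed

subsection \<open>Partial derivatives on a box\<close>

text \<open>Differentiability and value travel together, so a partial derivative of a compound
  expression can be computed by resolution with \<open>has_pd_intros\<close>, without separate
  differentiability goals.\<close>

definition has_pd :: "'n \<Rightarrow> (real^'n \<Rightarrow> real) \<Rightarrow> real^'n \<Rightarrow> real \<Rightarrow> bool" where
  "has_pd i F p d \<longleftrightarrow> F differentiable at p \<and> pd i F p = d"

lemma has_pdI: "(F has_derivative F') (at p) \<Longrightarrow> F' (axis i 1) = d \<Longrightarrow> has_pd i F p d"
  using pd_eqI[of F F' p i] by (auto simp: has_pd_def differentiable_def)

lemma has_pdD: "has_pd i F p d \<Longrightarrow> \<exists>F'. (F has_derivative F') (at p) \<and> F' (axis i 1) = d"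
  using has_derivative_frechet by (auto simp: has_pd_def pd_def)

lemma has_pd_const: "has_pd i (\<lambda>_. c) p 0"
  by (rule has_pdI[OF has_derivative_const]) simp

lemma has_pd_coord: "has_pd i (\<lambda>q. q $ j) p (if i = j then 1 else 0)"
  by (rule has_pdI[OF has_derivative_vec_nth[OF has_derivative_ident]]) (simp add: axis_def)

lemma has_pd_exp: "has_pd i (\<lambda>q. exp (b * q $ j)) p ((if i = j then b else 0) * exp (b * p $ j))"
  by (rule has_pdI[OF has_derivative_exp_coord]) (simp add: axis_def)

lemma has_pd_add: "has_pd i F p d \<Longrightarrow> has_pd i G p e \<Longrightarrow> has_pd i (\<lambda>q. F q + G q) p (d + e)"
  by (blast dest!: has_pdD intro: has_pdI[OF has_derivative_add])

lemma has_pd_diff: "has_pd i F p d \<Longrightarrow> has_pd i G p e \<Longrightarrow> has_pd i (\<lambda>q. F q - G q) p (d - e)"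
  by (blast dest!: has_pdD intro: has_pdI[OF has_derivative_diff])

lemma has_pd_minus: "has_pd i F p d \<Longrightarrow> has_pd i (\<lambda>q. - F q) p (- d)"
  by (blast dest!: has_pdD intro: has_pdI[OF has_derivative_minus])

lemma has_pd_cmult: "has_pd i F p d \<Longrightarrow> has_pd i (\<lambda>q. c * F q) p (c * d)"
  by (blast dest!: has_pdD intro: has_pdI[OF has_derivative_mult_right])

lemma has_pd_mult:
  "has_pd i F p d \<Longrightarrow> has_pd i G p e \<Longrightarrow> has_pd i (\<lambda>q. F q * G q) p (F p * e + d * G p)"
  by (blast dest!: has_pdD intro: has_pdI[OF has_derivative_mult])

lemma has_pd_compose_coord:
  assumes "(\<phi> has_field_derivative d) (at (p $ j))"
  shows "has_pd i (\<lambda>q. \<phi> (q $ j)) p (if i = j then d else 0)"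
  by (rule has_pdI[OF DERIV_compose_FDERIV[OF assms has_derivative_vec_nth[OF has_derivative_ident]]])
    (simp add: axis_def)

lemma has_pd_smooth: "smooth_on U F \<Longrightarrow> p \<in> U \<Longrightarrow> has_pd i F p (pd i F p)"
  by (simp add: has_pd_def smooth_on_differentiable)

text \<open>The device for differentiating an equation that holds on an open set: the right-hand
  side supplies the derivative of the left.\<close>

lemma pd_eq:
  assumes "open U" "\<And>q. q \<in> U \<Longrightarrow> F q = G q" "p \<in> U" "has_pd i G p d"
  shows "pd i F p = d"
proof -
  have "G differentiable at p"
    using assms(4) by (simp add: has_pd_def)
  from pd_cong[OF assms(1,2) this assms(3)] show ?thesis
    using assms(4) by (simp add: has_pd_def)
qed

lemmas has_pd_intros = has_pd_const has_pd_coord has_pd_exp has_pd_add has_pd_diff has_pd_minus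
  has_pd_cmult has_pd_mult

lemma open_coord_box: "open I \<Longrightarrow> open J \<Longrightarrow> open K \<Longrightarrow> open (coord_box I J K)"
proof -
  assume "open I" "open J" "open K"
  then have "open ((\<lambda>p::real^3. p $ 1) -` I \<inter> (\<lambda>p. p $ 2) -` J \<inter> (\<lambda>p. p $ 3) -` K)"
    by (intro open_Int open_vimage_vec_nth)
  then show ?thesis
    by (simp add: coord_box_def vimage_def Int_def conj_assoc)
qed

lemma convex_coord_box: "convex I \<Longrightarrow> convex J \<Longrightarrow> convex K \<Longrightarrow> convex (coord_box I J K)"
  by (simp add: convex_def coord_box_def)

text \<open>On the segment, \<open>H\<close> is a function of one real variable whose derivative is
  \<open>H' (q - p)\<close>, so it suffices that the derivative vanishes in this single
  direction.\<close>

lemma eq_if_derivative_along_segment_zero: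
  fixes H :: "'a::real_normed_vector \<Rightarrow> real"
  assumes "convex U" "p \<in> U" "q \<in> U"
    and "\<And>z. z \<in> U \<Longrightarrow> \<exists>H'. (H has_derivative H') (at z) \<and> H' (q - p) = 0"
  shows "H p = H q"
proof -
  let ?l = "\<lambda>s::real. p + s *\<^sub>R (q - p)"
  have l: "?l s \<in> U" if "0 \<le> s" "s \<le> 1" for s
  proof -
    have "?l s = (1 - s) *\<^sub>R p + s *\<^sub>R q"
      by (simp add: algebra_simps)
    then show ?thesis
      using convexD_alt[OF assms(1-3) that] by simp
  qed
  have "((\<lambda>s. H (?l s)) has_real_derivative 0) (at s)" if s: "0 \<le> s" "s \<le> 1" for s
  proof -
    obtain H' where H': "(H has_derivative H') (at (?l s))" "H' (q - p) = 0"
      using assms(4) l[OF s] by blast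
    have "(?l has_derivative (\<lambda>x. x *\<^sub>R (q - p))) (at s)"
      by (auto intro!: derivative_eq_intros)
    from diff_chain_at[OF this H'(1)] show ?thesis
      using linear_scale[OF has_derivative_linear[OF H'(1)]] H'(2)
      by (simp add: has_field_derivative_def o_def flip: lambda_zero)
  qed
  note d = this
  have "H (?l 1) = H (?l 0)"
  proof (rule DERIV_isconst2[where a = 0 and b = 1 and f = "\<lambda>s. H (?l s)" and x = 1])
    show "continuous_on {0..1} (\<lambda>s. H (?l s))"
      by (intro continuous_at_imp_continuous_on ballI DERIV_isCont[OF d]) auto
  qed (use d in auto)
  then show ?thesis
    by simp
qed

section \<open>Recovering functions on the box from their partial derivatives\<close>

locale walker_domain =
  fixes b :: real and I J K :: "real set" and M :: "(real^3) set"
  assumes b: "b \<noteq> 0"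
    and intervals: "open_interval I" "open_interval J" "open_interval K"
    and M: "M = coord_box I J K"
begin

lemma open_M: "open M"
  using intervals open_coord_box by (simp add: M open_interval_def)

lemma convex_M: "convex M"
  using intervals convex_coord_box by (simp add: M open_interval_def is_interval_convex)

lemmas pd_M_eq = pd_eq[OF open_M]
lemmas pd_M_commute = pd_commute[OF open_M]

lemma pd_const_M:
  fixes F :: "real^3 \<Rightarrow> real"
  assumes "\<And>q. q \<in> M \<Longrightarrow> F q = c" "p \<in> M"
  shows "pd i F p = 0"
  by (rule pd_M_eq[OF assms has_pd_const])

text \<open>The segment from \<open>p\<close> to \<open>q\<close> moves only in the directions of
  \<open>S\<close>. With all indices in \<open>S\<close> this gives constancy, with
  \<open>S = {1, 2}\<close> dependence on \<open>y\<close> alone.\<close>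

lemma eq_if_pd_zero:
  fixes F :: "real^3 \<Rightarrow> real"
  assumes "\<And>q i. q \<in> M \<Longrightarrow> i \<in> S \<Longrightarrow> has_pd i F q 0"
    and "p \<in> M" "q \<in> M" "\<And>i. i \<notin> S \<Longrightarrow> p $ i = q $ i" "S \<noteq> {}"
  shows "F p = F q"
proof (rule eq_if_derivative_along_segment_zero[OF convex_M assms(2,3)])
  fix z assume z: "z \<in> M"
  then have "F differentiable at z"
    using assms(1,5) unfolding has_pd_def by blast
  note d = has_derivative_frechet[OF this]
  have "(q - p) $ i *\<^sub>R pd i F z = 0" for i
    using assms(1)[OF z, of i] assms(4)[of i] by (cases "i \<in> S") (simp_all add: has_pd_def)
  then have "frechet_derivative F (at z) (q - p) = 0"
    unfolding has_derivative_expand[OF d] by (intro sum.neutral ballI)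
  with d show "\<exists>F'. (F has_derivative F') (at z) \<and> F' (q - p) = 0"
    by blast
qed

lemma M_nonempty: "\<exists>p. p \<in> M"
proof -
  obtain t x y where "t \<in> I" "x \<in> J" "y \<in> K"
    using intervals unfolding open_interval_def by blast
  then have "vector [t, x, y] \<in> M"
    by (simp add: M coord_box_def)
  then show ?thesis ..
qed

lemma affine_if_pd_const:
  fixes F :: "real^3 \<Rightarrow> real"
  assumes "smooth_on M F"
    and "\<And>p. p \<in> M \<Longrightarrow> pd 1 F p = a1" "\<And>p. p \<in> M \<Longrightarrow> pd 2 F p = a2" "\<And>p. p \<in> M \<Longrightarrow> pd 3 F p = a3"
  shows "\<exists>c. \<forall>p\<in>M. F p = a1 * p $ 1 + a2 * p $ 2 + a3 * p $ 3 + c"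
proof -
  define H where "H = (\<lambda>p. F p - (a1 * p $ 1 + a2 * p $ 2 + a3 * p $ 3))"
  have H: "has_pd i H p 0" if "p \<in> M" for p i
  proof -
    have "has_pd i H p (pd i F p - (a1 * (if i = 1 then 1 else 0) + a2 * (if i = 2 then 1 else 0)
        + a3 * (if i = 3 then 1 else 0)))"
      unfolding H_def by (intro has_pd_intros has_pd_smooth[OF assms(1) that])
    moreover have "\<dots> = 0"
      using exhaust_3[of i] assms(2-4)[OF that] by auto
    ultimately show ?thesis
      by (simp only:)
  qed
  have "H p = H q" if "p \<in> M" "q \<in> M" for p q
    by (rule eq_if_pd_zero[OF H that]) auto
  moreover obtain p0 where "p0 \<in> M"
    using M_nonempty by blast
  ultimately have "\<forall>p\<in>M. H p = H p0"
    by blast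
  then show ?thesis
    by (intro exI[of _ "H p0"]) (auto simp: H_def algebra_simps)
qed

lemma const_if_pd_zero:
  fixes F :: "real^3 \<Rightarrow> real"
  assumes "smooth_on M F" "\<And>p i. p \<in> M \<Longrightarrow> pd i F p = 0"
  shows "\<exists>c. \<forall>p\<in>M. F p = c"
  using affine_if_pd_const[OF assms(1) assms(2) assms(2) assms(2)] by simp

text \<open>Freezing \<open>t\<close> and \<open>x\<close> turns functions on the box into functions
  on \<open>K\<close> and preserves smoothness. The one-variable functions in the solutions arise in
  this way.\<close>

lemma obtain_section:
  obtains t x where "\<And>p. p \<in> M \<Longrightarrow> vector [t, x, p $ 3] \<in> M"
    and "\<And>F. smooth_on M F \<Longrightarrow> smooth_on K (\<lambda>y. F (vector [t, x, y]) :: real)"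
proof -
  obtain t x where tx: "t \<in> I" "x \<in> J"
    using intervals unfolding open_interval_def by blast
  show thesis
  proof
    show "vector [t, x, p $ 3] \<in> M" if "p \<in> M" for p
      using that tx by (simp add: M coord_box_def)
    fix F :: "real^3 \<Rightarrow> real" assume F: "smooth_on M F"
    \<comment> \<open>The base point \<open>a\<close> may lie outside \<open>M\<close>, since
      \<open>0\<close> may lie outside \<open>K\<close>; only the points with third coordinate in
      \<open>K\<close> matter.\<close>
    define a :: "real^3" where "a = vector [t, x, 0]"
    have eq: "vector [t, x, y] = a + y *\<^sub>R axis 3 1" for y
      by (simp add: a_def vec_eq_iff forall_3 axis_def)
    show "smooth_on K (\<lambda>y. F (vector [t, x, y]))"
      unfolding eq
    proof (rule smooth_on_affine[OF bounded_linear_scaleR_left open_M _ _ F])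
      show "a + y *\<^sub>R axis 3 1 \<in> M" if "y \<in> K" for y
        using that tx by (simp add: M coord_box_def flip: eq)
    qed (use intervals in \<open>simp add: open_interval_def\<close>)
  qed
qed

lemma pd_compose_third:
  fixes F :: "real^3 \<Rightarrow> real"
  assumes "smooth_on K \<phi>" "\<And>q. q \<in> M \<Longrightarrow> F q = \<phi> (q $ 3)" "p \<in> M"
  shows "pd i F p = (if i = 3 then deriv \<phi> (p $ 3) else 0)"
proof (rule pd_M_eq[OF assms(2,3)])
  have "p $ 3 \<in> K"
    using assms(3) by (simp add: M coord_box_def)
  then show "has_pd i (\<lambda>q. \<phi> (q $ 3)) p (if i = 3 then deriv \<phi> (p $ 3) else 0)"
    by (intro has_pd_compose_coord smooth_on_has_deriv[OF assms(1)])
qed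

lemma function_of_third:
  fixes F :: "real^3 \<Rightarrow> real"
  assumes "smooth_on M F" "\<And>p. p \<in> M \<Longrightarrow> pd 1 F p = 0" "\<And>p. p \<in> M \<Longrightarrow> pd 2 F p = 0"
  shows "\<exists>\<phi>. smooth_on K \<phi> \<and> (\<forall>p\<in>M. F p = \<phi> (p $ 3))"
proof -
  obtain t x where tx: "\<And>p. p \<in> M \<Longrightarrow> vector [t, x, p $ 3] \<in> M"
    "\<And>F. smooth_on M F \<Longrightarrow> smooth_on K (\<lambda>y. F (vector [t, x, y]) :: real)"
    using obtain_section by blast
  have "F p = F (vector [t, x, p $ 3])" if "p \<in> M" for p
  proof (rule eq_if_pd_zero[of "{1, 2}"])
    show "has_pd i F q 0" if "q \<in> M" "i \<in> {1, 2}" for q i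
      using has_pd_smooth[OF assms(1) that(1), of i] assms(2,3) that by auto
    show "p $ i = vector [t, x, p $ 3] $ i" if "i \<notin> {1, 2}" for i
      using that exhaust_3[of i] by auto
  qed (use that tx in auto)
  then show ?thesis
    using tx(2)[OF assms(1)] by blast
qed

text \<open>Differentiating in \<open>x\<close> removes \<open>G\<close> and reproduces the
  exponential, which can then be cancelled. Here \<open>F\<close> may still depend on
  \<open>x\<close>; this is the form for coefficients whose independence of \<open>x\<close> is not
  yet known.\<close>

lemma pd_exp_relation:
  fixes F G :: "real^3 \<Rightarrow> real"
  assumes "smooth_on M F" "smooth_on M G"
    and "\<And>p. p \<in> M \<Longrightarrow> exp (b * p $ 2) * F p + G p = 0" "\<And>p. p \<in> M \<Longrightarrow> pd 2 G p = 0" "p \<in> M"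
  shows "pd 2 F p = - b * F p"
proof -
  have "pd 2 (\<lambda>p. exp (b * p $ 2) * F p + G p) p =
      exp (b * p $ 2) * pd 2 F p + ((if (2::3) = 2 then b else 0) * exp (b * p $ 2)) * F p + pd 2 G p"
    by (rule pd_M_eq[OF refl assms(5)])
      (rule has_pd_add has_pd_mult has_pd_exp has_pd_smooth assms)+
  moreover have "pd 2 (\<lambda>p. exp (b * p $ 2) * F p + G p) p = 0"
    by (rule pd_const_M[OF assms(3,5)])
  ultimately have "exp (b * p $ 2) * (pd 2 F p + b * F p) = 0"
    using assms(4,5) by (simp add: algebra_simps)
  then show ?thesis
    by simp
qed

subsection \<open>Solving the differential systems\<close>

lemmas has_pd_M = has_pd_smooth[where U = M]

lemma smooth_on_M_add:
  "smooth_on M F \<Longrightarrow> smooth_on M G \<Longrightarrow> smooth_on M (\<lambda>p. F p + G p)"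
  by (rule smooth_on_add[OF open_M])

lemma smooth_on_M_cmult:
  fixes F :: "real^3 \<Rightarrow> real"
  shows "smooth_on M F \<Longrightarrow> smooth_on M (\<lambda>p. c * F p)"
  by (rule smooth_on_bounded_linear[OF bounded_linear_mult_right open_M])

lemma smooth_on_M_nth: "smooth_on M X \<Longrightarrow> smooth_on M (\<lambda>p. X p $ i)"
  by (rule smooth_on_vec_nth[OF open_M])

lemmas smooth_M_intros = smooth_on_M_add smooth_on_M_cmult smooth_on_const smooth_on_pd

lemma pd_commute3:
  fixes F :: "real^3 \<Rightarrow> real"
  assumes "smooth_on M F" "p \<in> M"
  shows "pd i (pd j (pd k F)) p = pd j (pd k (pd i F)) p"
proof -
  have "pd i (pd j (pd k F)) p = pd j (pd i (pd k F)) p"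
    using assms by (intro pd_M_commute smooth_on_pd)
  also have "\<dots> = pd j (pd k (pd i F)) p"
    using pd_M_eq[OF pd_M_commute[OF assms(1), of _ i k] assms(2)
        has_pd_smooth[OF smooth_on_pd[OF smooth_on_pd[OF assms(1)]] assms(2)]] .
  finally show ?thesis .
qed

lemma pd_pd_zero:
  fixes F :: "real^3 \<Rightarrow> real"
  assumes "smooth_on M F" "p \<in> M" "\<And>q. q \<in> M \<Longrightarrow> pd j F q = c"
  shows "pd i (pd j F) p = 0" "pd j (pd i F) p = 0"
proof -
  show "pd i (pd j F) p = 0"
    by (rule pd_const_M[OF assms(3,2)])
  then show "pd j (pd i F) p = 0"
    using pd_M_commute[OF assms(1,2)] by simp
qed

lemma pd_cmult_M:
  fixes F :: "real^3 \<Rightarrow> real"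
  assumes "smooth_on M F" "p \<in> M"
  shows "pd i (\<lambda>q. k * F q) p = k * pd i F p"
  by (rule pd_M_eq[OF refl assms(2) has_pd_cmult[OF has_pd_smooth[OF assms]]])

text \<open>With \<open>pd 2 F = 0\<close>, the relation \<open>pd 2 F = - b * F\<close> leaves
  \<open>F = 0\<close>, and then \<open>G = 0\<close>.\<close>

lemma exp_independent:
  fixes F G :: "real^3 \<Rightarrow> real"
  assumes "smooth_on M F" "smooth_on M G" "k \<noteq> 0"
    and "\<And>p. p \<in> M \<Longrightarrow> exp (b * p $ 2) * F p = k * G p"
    and "\<And>p. p \<in> M \<Longrightarrow> pd 2 F p = 0" "\<And>p. p \<in> M \<Longrightarrow> pd 2 G p = 0" "p \<in> M"
  shows "F p = 0 \<and> G p = 0"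
proof -
  have "pd 2 F p = - b * F p"
    by (rule pd_exp_relation[of F "\<lambda>p. (- k) * G p"])
      (use assms smooth_on_M_cmult[of G "- k"] pd_cmult_M[of G _ _ "- k"] in auto)
  then show ?thesis
    using assms(3) assms(4)[OF assms(7)] assms(5)[OF assms(7)] b by auto
qed

text \<open>Here \<open>A\<close>, \<open>B\<close>, \<open>C\<close> are the components of
  \<open>X\<close>, and each hypothesis \<open>kij\<close> is the component with indices
  \<open>i\<close>, \<open>j\<close> of the homothety equation, where \<open>k13\<close> is
  simplified by \<open>k11\<close> and \<open>k33\<close> is multiplied by
  \<open>- b\<^sup>2 / 2\<close>. The unknown factor \<open>\<eta>\<close> is carried along until
  the equations determine it.\<close>

lemma killing_system:
  fixes A B C :: "real^3 \<Rightarrow> real"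
  assumes sm: "smooth_on M A" "smooth_on M B" "smooth_on M C"
    and k11: "\<And>p. p \<in> M \<Longrightarrow> pd 1 C p = 0"
    and k12: "\<And>p. p \<in> M \<Longrightarrow> pd 2 C p + pd 1 B p = 0"
    and k13: "\<And>p. p \<in> M \<Longrightarrow> pd 3 C p + pd 1 A p = \<eta>"
    and k22: "\<And>p. p \<in> M \<Longrightarrow> 2 * pd 2 B p = \<eta>"
    and k23: "\<And>p. p \<in> M \<Longrightarrow> pd 2 A p + pd 3 B p - 2 / b\<^sup>2 * (exp (b * p $ 2) * pd 2 C p) = 0"
    and k33: "\<And>p. p \<in> M \<Longrightarrow>
      exp (b * p $ 2) * (b * B p + 2 * pd 3 C p - \<eta>) - b\<^sup>2 * pd 3 A p = 0"
  shows "\<eta> = 0 \<and> (\<exists>c1 c2 c3. \<forall>p\<in>M. A p = c1 * p $ 1 + c2 \<and> B p = 2 * c1 / b \<and> C p = - c1 * p $ 3 + c3)"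
proof -
  note sd = has_pd_smooth[OF smooth_on_pd] has_pd_smooth
  have B2: "pd 2 B p = \<eta> / 2" if "p \<in> M" for p
    using k22[OF that] by simp
  have B12: "pd 1 (pd 2 B) p = 0" if "p \<in> M" for p
    by (rule pd_pd_zero[OF sm(2) that B2])
  have C13: "pd 1 (pd i C) p = 0" if "p \<in> M" for p i
    by (rule pd_pd_zero[OF sm(3) that k11])
  \<comment> \<open>Writing indices for partial derivatives: \<open>k12\<close> gives
    \<open>C_23 = - B_13\<close>, the \<open>t\<close>-derivative of \<open>k23\<close> gives
    \<open>A_12 = - B_13\<close>, and the \<open>x\<close>-derivative of \<open>k13\<close> gives
    \<open>A_12 = - C_23\<close>. Hence \<open>C_23\<close> equals its own negative.\<close>
  have C23: "pd 2 (pd 3 C) p = 0" if p: "p \<in> M" for p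
  proof -
    have C2: "pd 2 C q = - pd 1 B q" and A1: "pd 1 A q = \<eta> - pd 3 C q"
      and A2: "pd 2 A q = - pd 3 B q + 2 / b\<^sup>2 * (exp (b * q $ 2) * pd 2 C q)" if "q \<in> M" for q
      using k12[OF that] k13[OF that] k23[OF that] by auto
    have "pd 2 (pd 3 C) p = pd 3 (pd 2 C) p"
      by (rule pd_M_commute[OF sm(3) p])
    also have "\<dots> = - pd 3 (pd 1 B) p"
      by (rule pd_M_eq[OF C2 p has_pd_minus[OF has_pd_smooth[OF smooth_on_pd[OF sm(2)] p]]])
    finally have 1: "pd 2 (pd 3 C) p = - pd 1 (pd 3 B) p"
      using pd_M_commute[OF sm(2) p] by metis
    have "pd 1 (pd 2 A) p = - pd 1 (pd 3 B) p + 2 / b\<^sup>2 * (exp (b * p $ 2) * pd 1 (pd 2 C) p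
        + (if (1::3) = 2 then b else 0) * exp (b * p $ 2) * pd 2 C p)"
      by (rule pd_M_eq[OF A2 p], assumption) (intro has_pd_intros has_pd_M smooth_on_pd sm p)+
    then have 2: "pd 1 (pd 2 A) p = - pd 1 (pd 3 B) p"
      using C13[OF p] by simp
    have "pd 2 (pd 1 A) p = 0 - pd 2 (pd 3 C) p"
      by (rule pd_M_eq[OF A1 p], assumption) (intro has_pd_intros has_pd_M smooth_on_pd sm p)+
    with 1 2 show ?thesis
      using pd_M_commute[OF sm(1) p, of 1 2] by simp
  qed
  have C233: "pd 2 (pd 3 (pd 3 C)) p = 0" if "p \<in> M" for p
    by (rule pd_pd_zero[OF smooth_on_pd[OF sm(3)] that C23])
  \<comment> \<open>The \<open>t\<close>-derivative of \<open>k33\<close>, with the mixed derivative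
    of \<open>A\<close> eliminated by \<open>k13\<close>. Both \<open>pd 1 B\<close> and
    \<open>pd 3 (pd 3 C)\<close> are independent of \<open>x\<close>, so they will vanish
    separately.\<close>
  have e: "exp (b * p $ 2) * pd 1 B p = - b * pd 3 (pd 3 C) p" if p: "p \<in> M" for p
  proof -
    have A1: "pd 1 A q = \<eta> - pd 3 C q" if "q \<in> M" for q
      using k13[OF that] by auto
    have "pd 3 (pd 1 A) p = 0 - pd 3 (pd 3 C) p"
      by (rule pd_M_eq[OF A1 p], assumption) (intro has_pd_intros has_pd_M smooth_on_pd sm p)+
    then have A13: "pd 1 (pd 3 A) p = - pd 3 (pd 3 C) p"
      using pd_M_commute[OF sm(1) p, of 1 3] by simp
    let ?E = "\<lambda>p. exp (b * p $ 2) * (b * B p + 2 * pd 3 C p - \<eta>) - b\<^sup>2 * pd 3 A p"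
    have "pd 1 ?E p = 0"
      by (rule pd_const_M[OF _ p]) (rule k33)
    moreover have "pd 1 ?E p = exp (b * p $ 2) * (b * pd 1 B p + 2 * pd 1 (pd 3 C) p - 0)
        + ((if (1::3) = 2 then b else 0) * exp (b * p $ 2)) * (b * B p + 2 * pd 3 C p - \<eta>)
        - b\<^sup>2 * pd 1 (pd 3 A) p"
      by (rule pd_M_eq[OF refl p])
        (intro has_pd_intros has_pd_M smooth_on_pd sm p)+
    ultimately have "b * (exp (b * p $ 2) * pd 1 B p + b * pd 3 (pd 3 C) p) = 0"
      using C13[OF p] A13 by (simp add: algebra_simps power2_eq_square)
    then have "exp (b * p $ 2) * pd 1 B p + b * pd 3 (pd 3 C) p = 0"
      using b by simp
    then show ?thesis
      by (simp add: add_eq_0_iff2)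
  qed
  have B1: "pd 1 B p = 0" and C33: "pd 3 (pd 3 C) p = 0" if "p \<in> M" for p
  proof -
    have "pd 1 B p = 0 \<and> pd 3 (pd 3 C) p = 0"
    proof (rule exp_independent[where k = "- b"])
      show "pd 2 (pd 1 B) q = 0" if "q \<in> M" for q
        by (rule pd_pd_zero[OF sm(2) that B2])
    qed (use b sm that in \<open>simp_all add: smooth_on_pd e C233\<close>)
    then show "pd 1 B p = 0" "pd 3 (pd 3 C) p = 0"
      by auto
  qed
  have "pd i (pd 3 C) p = 0" if "p \<in> M" for p i
    using exhaust_3[of i] C13[OF that] C23[OF that] C33[OF that] by auto
  then obtain c where C3: "\<And>p. p \<in> M \<Longrightarrow> pd 3 C p = c"
    using const_if_pd_zero[OF smooth_on_pd[OF sm(3)], of 3] by blast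
  have C2: "pd 2 C p = 0" if "p \<in> M" for p
    using k12[OF that] B1[OF that] by simp
  have A2: "pd 2 A q = - pd 3 B q" if "q \<in> M" for q
    using k23[OF that] C2[OF that] by simp
  \<comment> \<open>The coefficient of the exponential in the \<open>x\<close>-derivative of
    \<open>k33\<close>: the first summand comes from differentiating the exponential, the second
    from \<open>pd 2 B = \<eta> / 2\<close>.\<close>
  define F where "F = (\<lambda>p. b * (b * B p + (2 * c - \<eta>)) + b * \<eta> / 2)"
  have smF: "smooth_on M F"
    unfolding F_def by (intro smooth_M_intros sm)
  have F2: "pd 2 F p = b\<^sup>2 * \<eta> / 2" if p: "p \<in> M" for p
  proof -
    have "pd 2 F p = b * (b * pd 2 B p + 0) + 0"
      unfolding F_def by (rule pd_M_eq[OF refl p]) (intro has_pd_intros has_pd_M smooth_on_pd sm p)+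
    then show ?thesis
      using B2[OF p] by (simp add: power2_eq_square)
  qed
  have e2: "exp (b * p $ 2) * F p + b\<^sup>2 * pd 3 (pd 3 B) p = 0" if p: "p \<in> M" for p
  proof -
    have k33': "exp (b * p $ 2) * (b * B p + (2 * c - \<eta>)) - b\<^sup>2 * pd 3 A p = 0" if "p \<in> M" for p
      using k33[OF that] C3[OF that] by (simp add: algebra_simps)
    have "pd 3 (pd 2 A) p = - pd 3 (pd 3 B) p"
      by (rule pd_M_eq[OF A2 p], assumption) (intro has_pd_intros has_pd_M smooth_on_pd sm p)+
    then have A23: "pd 2 (pd 3 A) p = - pd 3 (pd 3 B) p"
      using pd_M_commute[OF sm(1) p, of 2 3] by simp
    let ?E = "\<lambda>p. exp (b * p $ 2) * (b * B p + (2 * c - \<eta>)) - b\<^sup>2 * pd 3 A p"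
    have "pd 2 ?E p = 0"
      by (rule pd_const_M[OF _ p]) (rule k33')
    moreover have "pd 2 ?E p = exp (b * p $ 2) * (b * pd 2 B p + 0)
        + ((if (2::3) = 2 then b else 0) * exp (b * p $ 2)) * (b * B p + (2 * c - \<eta>))
        - b\<^sup>2 * pd 2 (pd 3 A) p"
      by (rule pd_M_eq[OF refl p])
        (intro has_pd_intros has_pd_M smooth_on_pd sm p)+
    ultimately show ?thesis
      using A23 B2[OF p] by (simp add: F_def algebra_simps)
  qed
  have z2: "pd 2 (\<lambda>p. b\<^sup>2 * pd 3 (pd 3 B) p) p = 0" if p: "p \<in> M" for p
  proof -
    have "pd 2 (pd 3 B) q = 0" if "q \<in> M" for q
      by (rule pd_pd_zero[OF sm(2) that B2])
    then have "pd 2 (pd 3 (pd 3 B)) p = 0"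
      by (rule pd_pd_zero[OF smooth_on_pd[OF sm(2)] p])
    then show ?thesis
      using p sm by (simp add: pd_cmult_M smooth_on_pd)
  qed
  \<comment> \<open>The slope of \<open>F\<close> in \<open>x\<close> is
    \<open>b\<^sup>2 * \<eta> / 2\<close> by \<open>F2\<close> and \<open>- b * F\<close> by the
    exponential relation; comparing the two determines \<open>F\<close>.\<close>
  have F: "F p = - b * \<eta> / 2" if "p \<in> M" for p
  proof -
    have "pd 2 F p = - b * F p"
      by (rule pd_exp_relation[OF smF _ _ _ that, of "\<lambda>p. b\<^sup>2 * pd 3 (pd 3 B) p"])
        (use e2 z2 in \<open>auto intro!: smooth_M_intros sm\<close>)
    then have "b * (2 * F p + b * \<eta>) = 0"
      using F2[OF that] by (simp add: power2_eq_square algebra_simps)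
    then have "2 * F p + b * \<eta> = 0"
      using b by simp
    then show ?thesis
      by simp
  qed
  obtain p0 where p0: "p0 \<in> M"
    using M_nonempty by blast
  \<comment> \<open>\<open>F\<close> is now constant, so its slope
    \<open>b\<^sup>2 * \<eta> / 2\<close> is zero. This is why every homothetic field is
    Killing.\<close>
  have "pd 2 F p0 = 0"
    by (rule pd_const_M[OF F p0])
  then have \<eta>: "\<eta> = 0"
    using F2[OF p0] b by simp
  have B: "B p = 2 * (- c) / b" if "p \<in> M" for p
  proof -
    have "b * (b * B p + 2 * c) = 0"
      using F[OF that] \<eta> by (simp add: F_def)
    then have "b * B p + 2 * c = 0"
      using b by simp
    then show ?thesis
      using b by (simp add: field_simps)
  qed
  have "pd 3 B p = 0" if "p \<in> M" for p
    using B that by (rule pd_const_M)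
  moreover have "pd 3 A p = 0" if "p \<in> M" for p
    using k33[OF that] B[OF that] C3[OF that] \<eta> b by (simp add: field_simps)
  ultimately obtain c2 where "\<forall>p\<in>M. A p = (- c) * p $ 1 + 0 * p $ 2 + 0 * p $ 3 + c2"
    using affine_if_pd_const[OF sm(1), of "- c" 0 0] k13 C3 \<eta> A2 by force
  moreover obtain c3 where "\<forall>p\<in>M. C p = 0 * p $ 1 + 0 * p $ 2 + c * p $ 3 + c3"
    using affine_if_pd_const[OF sm(3), of 0 0 c] k11 C2 C3 by blast
  ultimately show ?thesis
    using \<eta> B by (intro conjI exI[of _ "- c"] exI[of _ c2] exI[of _ c3]) auto
qed

text \<open>The system is triangular: the equations with upper index \<open>3\<close> involve
  \<open>C\<close> alone, those with upper index \<open>2\<close> involve \<open>B\<close> and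
  \<open>C\<close>, and \<open>A\<close> occurs only in those with upper index \<open>1\<close>.
  Solving for \<open>C\<close>, then \<open>B\<close>, then \<open>A\<close> makes each stage a
  separation of the exponential.\<close>

lemma affine_system:
  fixes A B C :: "real^3 \<Rightarrow> real"
  assumes sm: "smooth_on M A" "smooth_on M B" "smooth_on M C"
    and C12: "\<And>p. p \<in> M \<Longrightarrow> pd 1 (pd 2 C) p = 0" and C22: "\<And>p. p \<in> M \<Longrightarrow> pd 2 (pd 2 C) p = 0"
    and C23: "\<And>p. p \<in> M \<Longrightarrow> exp (b * p $ 2) * pd 1 C p + b * pd 2 (pd 3 C) p = 0"
    and C33: "\<And>p. p \<in> M \<Longrightarrow> exp (b * p $ 2) * pd 2 C p - b * pd 3 (pd 3 C) p = 0"
    and B12: "\<And>p. p \<in> M \<Longrightarrow> pd 1 (pd 2 B) p = 0" and B22: "\<And>p. p \<in> M \<Longrightarrow> pd 2 (pd 2 B) p = 0"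
    and B23: "\<And>p. p \<in> M \<Longrightarrow>
      exp (b * p $ 2) * (pd 1 B p + pd 2 C p) + b * pd 2 (pd 3 B) p = 0"
    and B33: "\<And>p. p \<in> M \<Longrightarrow>
      exp (b * p $ 2) * (b * B p - pd 2 B p + 2 * pd 3 C p) + b * pd 3 (pd 3 B) p = 0"
    and A12': "\<And>p. p \<in> M \<Longrightarrow> exp (b * p $ 2) * pd 1 C p - b * pd 1 (pd 2 A) p = 0"
    and A22': "\<And>p. p \<in> M \<Longrightarrow> 2 * exp (b * p $ 2) * pd 2 C p - b * pd 2 (pd 2 A) p = 0"
    and A13: "\<And>p. p \<in> M \<Longrightarrow> exp (b * p $ 2) * pd 1 B p - b * pd 1 (pd 3 A) p = 0"
    and A23: "\<And>p. p \<in> M \<Longrightarrow> exp (b * p $ 2) * (b * B p - pd 1 A p + pd 2 B p + pd 3 C p)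
      - b * pd 2 (pd 3 A) p = 0"
    and A33: "\<And>p. p \<in> M \<Longrightarrow> exp (b * p $ 2) * (pd 2 A p + 2 * pd 3 B p) - b * pd 3 (pd 3 A) p = 0"
    and C13: "\<And>p. p \<in> M \<Longrightarrow> pd 1 (pd 3 C) p = 0"
  shows "\<exists>c1 c2 c3 c4. \<forall>p\<in>M. A p = c1 * p $ 1 + c2 + c4 * p $ 3 \<and> B p = 2 * c1 / b
    \<and> C p = - c1 * p $ 3 + c3"
proof -
  note sc = smooth_M_intros sm
  \<comment> \<open>Supplies the independence of \<open>x\<close> for the terms outside the
    exponential: these are derivatives in \<open>y\<close>, and the vanishing of
    \<open>pd 2 (pd i F)\<close> is inherited by \<open>pd 3 F\<close>.\<close>
  have z: "pd 2 (pd i (pd 3 F)) p = 0"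
    if "smooth_on M F" "\<And>p. p \<in> M \<Longrightarrow> pd 2 (pd i F) p = 0" "p \<in> M"
    for i p and F :: "real^3 \<Rightarrow> real"
  proof -
    have "pd 2 (pd i (pd 3 F)) p = pd i (pd 3 (pd 2 F)) p"
      by (rule pd_commute3[OF that(1,3)])
    also have "\<dots> = pd 3 (pd 2 (pd i F)) p"
      by (rule pd_commute3[OF that(1,3)])
    also have "\<dots> = 0"
      by (rule pd_const_M[OF that(2,3)])
    finally show ?thesis .
  qed
  have b': "- b \<noteq> 0"
    using b by simp
  have C1: "pd 1 C p = 0" and C23': "pd 2 (pd 3 C) p = 0" if p: "p \<in> M" for p
  proof -
    have "pd 1 C p = 0 \<and> pd 2 (pd 3 C) p = 0"
    proof (rule exp_independent[OF _ _ b' _ _ _ p])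
      show "exp (b * p $ 2) * pd 1 C p = - b * pd 2 (pd 3 C) p" if "p \<in> M" for p
        using C23[OF that] by (simp add: add_eq_0_iff2)
      show "pd 2 (pd 1 C) p = 0" if "p \<in> M" for p
        using pd_M_commute[OF sm(3) that, of 2 1] C12[OF that] by simp
      show "pd 2 (pd 2 (pd 3 C)) p = 0" if "p \<in> M" for p
        by (rule z[OF sm(3) C22 that])
    qed (intro sc)+
    then show "pd 1 C p = 0" "pd 2 (pd 3 C) p = 0"
      by auto
  qed
  have C2: "pd 2 C p = 0" and C33': "pd 3 (pd 3 C) p = 0" if p: "p \<in> M" for p
  proof -
    have "pd 2 C p = 0 \<and> pd 3 (pd 3 C) p = 0"
    proof (rule exp_independent[OF _ _ b _ _ _ p])
      show "exp (b * p $ 2) * pd 2 C p = b * pd 3 (pd 3 C) p" if "p \<in> M" for p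
        using C33[OF that] by simp
      show "pd 2 (pd 3 (pd 3 C)) p = 0" if "p \<in> M" for p
        by (rule z[OF sm(3) C23' that])
    qed (intro sc C22; assumption)+
    then show "pd 2 C p = 0" "pd 3 (pd 3 C) p = 0"
      by auto
  qed
  have "pd i (pd 3 C) p = 0" if "p \<in> M" for p i
    using exhaust_3[of i] C13[OF that] C23'[OF that] C33'[OF that] by auto
  then obtain c where C3: "\<And>p. p \<in> M \<Longrightarrow> pd 3 C p = c"
    using const_if_pd_zero[OF smooth_on_pd[OF sm(3)], of 3] by blast
  have B1: "pd 1 B p = 0" and B23': "pd 2 (pd 3 B) p = 0" if p: "p \<in> M" for p
  proof -
    have "pd 1 B p = 0 \<and> pd 2 (pd 3 B) p = 0"
    proof (rule exp_independent[OF _ _ b' _ _ _ p])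
      show "exp (b * p $ 2) * pd 1 B p = - b * pd 2 (pd 3 B) p" if "p \<in> M" for p
        using B23[OF that] C2[OF that] by (simp add: add_eq_0_iff2)
      show "pd 2 (pd 1 B) p = 0" if "p \<in> M" for p
        using pd_M_commute[OF sm(2) that, of 2 1] B12[OF that] by simp
      show "pd 2 (pd 2 (pd 3 B)) p = 0" if "p \<in> M" for p
        by (rule z[OF sm(2) B22 that])
    qed (intro sc)+
    then show "pd 1 B p = 0" "pd 2 (pd 3 B) p = 0"
      by auto
  qed
  have B: "B p = - 2 * c / b" if p: "p \<in> M" for p
  proof -
    \<comment> \<open>\<open>B\<close> is so far only affine in \<open>x\<close>. Since
      \<open>pd 2 (pd 2 B) = 0\<close>, the slope of \<open>F\<close> is \<open>b * pd 2 B\<close>;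
      in \<open>pd 2 F = - b * F\<close> the terms with \<open>pd 2 B\<close> cancel and
      \<open>b * B p + 2 * c = 0\<close> remains.\<close>
    define F where "F = (\<lambda>p. b * B p + (- 1) * pd 2 B p + 2 * c)"
    have "pd 2 F p = b * pd 2 B p + (- 1) * pd 2 (pd 2 B) p + 0"
      unfolding F_def
      by (rule pd_M_eq[OF refl p]) (intro has_pd_intros has_pd_M smooth_on_pd sm p)+
    moreover have "pd 2 F p = - b * F p"
    proof (rule pd_exp_relation[OF _ _ _ _ p])
      show "smooth_on M F"
        unfolding F_def by (intro sc)
      show "smooth_on M (\<lambda>p. b * pd 3 (pd 3 B) p)"
        by (intro sc)
      show "exp (b * p $ 2) * F p + b * pd 3 (pd 3 B) p = 0" if "p \<in> M" for p
        using B33[OF that] C3[OF that] by (simp add: F_def)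
      show "pd 2 (\<lambda>p. b * pd 3 (pd 3 B) p) p = 0" if "p \<in> M" for p
        using z[OF sm(2) B23' that] that by (simp add: pd_cmult_M sc)
    qed
    ultimately have "b * (b * B p + 2 * c) = 0"
      using B22[OF p] by (simp add: F_def algebra_simps)
    then have "b * B p + 2 * c = 0"
      using b by simp
    then show ?thesis
      using b by (simp add: field_simps)
  qed
  have Bi: "pd i B p = 0" if "p \<in> M" for p i
    using B that by (rule pd_const_M)
  have A12: "pd 1 (pd 2 A) p = 0" and A22: "pd 2 (pd 2 A) p = 0" if "p \<in> M" for p
    using A12'[OF that] A22'[OF that] C1[OF that] C2[OF that] b by auto
  have A1: "pd 1 A p = - c" and A23': "pd 2 (pd 3 A) p = 0" if p: "p \<in> M" for p
  proof -
    \<comment> \<open>What remains of the bracket in \<open>A23\<close> when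
      \<open>b * B p = - 2 * c\<close>, \<open>pd 2 B p = 0\<close> and \<open>pd 3 C p = c\<close>
      are inserted.\<close>
    define F where "F = (\<lambda>p. (- 1) * pd 1 A p + (- c))"
    have "F p = 0 \<and> pd 2 (pd 3 A) p = 0"
    proof (rule exp_independent[OF _ _ b _ _ _ p])
      show "smooth_on M F"
        unfolding F_def by (intro sc)
      show "exp (b * p $ 2) * F p = b * pd 2 (pd 3 A) p" if "p \<in> M" for p
        using A23[OF that] C3[OF that] B[OF that] Bi[OF that] b by (simp add: F_def algebra_simps)
      show "pd 2 F p = 0" if p: "p \<in> M" for p
      proof -
        have "pd 2 F p = (- 1) * pd 2 (pd 1 A) p + 0"
          unfolding F_def
          by (rule pd_M_eq[OF refl p]) (intro has_pd_intros has_pd_M smooth_on_pd sm p)+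
        then show ?thesis
          using A12[OF p] pd_M_commute[OF sm(1) p, of 2 1] by simp
      qed
      show "pd 2 (pd 2 (pd 3 A)) p = 0" if "p \<in> M" for p
        by (rule z[OF sm(1) A22 that])
    qed (intro sc)
    then show "pd 1 A p = - c" "pd 2 (pd 3 A) p = 0"
      by (auto simp: F_def)
  qed
  have A2: "pd 2 A p = 0" and A33': "pd 3 (pd 3 A) p = 0" if p: "p \<in> M" for p
  proof -
    have "pd 2 A p = 0 \<and> pd 3 (pd 3 A) p = 0"
    proof (rule exp_independent[OF _ _ b _ _ _ p])
      show "exp (b * p $ 2) * pd 2 A p = b * pd 3 (pd 3 A) p" if "p \<in> M" for p
        using A33[OF that] Bi[OF that] by simp
      show "pd 2 (pd 3 (pd 3 A)) p = 0" if "p \<in> M" for p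
        by (rule z[OF sm(1) A23' that])
    qed (intro sc A22; assumption)+
    then show "pd 2 A p = 0" "pd 3 (pd 3 A) p = 0"
      by auto
  qed
  have "pd i (pd 3 A) p = 0" if "p \<in> M" for p i
    using exhaust_3[of i] A13[OF that] A23'[OF that] A33'[OF that] B1[OF that] b by auto
  then obtain c4 where A3: "\<And>p. p \<in> M \<Longrightarrow> pd 3 A p = c4"
    using const_if_pd_zero[OF smooth_on_pd[OF sm(1)], of 3] by blast
  obtain c2 where "\<forall>p\<in>M. A p = (- c) * p $ 1 + 0 * p $ 2 + c4 * p $ 3 + c2"
    using affine_if_pd_const[OF sm(1) A1 A2 A3] by blast
  moreover obtain c3 where "\<forall>p\<in>M. C p = 0 * p $ 1 + 0 * p $ 2 + c * p $ 3 + c3"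
    using affine_if_pd_const[OF sm(3) C1 C2 C3] by blast
  ultimately show ?thesis
    using B by (intro exI[of _ "- c"] exI[of _ c2] exI[of _ c3] exI[of _ c4]) auto
qed

subsection \<open>Symmetries in components\<close>

lemma frechet_derivative_component:
  assumes "smooth_on M X" "p \<in> M"
  shows "frechet_derivative X (at p) v $ l = v $ 1 * pd 1 (\<lambda>q. X q $ l) p
    + v $ 2 * pd 2 (\<lambda>q. X q $ l) p + v $ 3 * pd 3 (\<lambda>q. X q $ l) p"
proof -
  have "(X has_derivative frechet_derivative X (at p)) (at p)"
    by (rule has_derivative_frechet[OF smooth_on_differentiable[OF assms]])
  from has_derivative_expand[OF has_derivative_vec_nth[OF this]] show ?thesis
    by (simp add: sum_3)
qed

lemma smooth_has_derivative:
  "smooth_on M X \<Longrightarrow> p \<in> M \<Longrightarrow> (X has_derivative frechet_derivative X (at p)) (at p)"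
  by (rule has_derivative_frechet[OF smooth_on_differentiable])

text \<open>Constant fields are smooth and take every pair of values at a given point, so a
  condition that depends only on values at \<open>p\<close> may be tested on tangent
  vectors.\<close>

lemma all_fields_iff:
  assumes "\<And>Y Z p. smooth_on M Y \<Longrightarrow> smooth_on M Z \<Longrightarrow> p \<in> M \<Longrightarrow> \<Phi> Y Z p \<longleftrightarrow> P p (Y p) (Z p)"
  shows "(\<forall>Y Z. smooth_on M Y \<longrightarrow> smooth_on M Z \<longrightarrow> (\<forall>p\<in>M. \<Phi> Y Z p)) \<longleftrightarrow> (\<forall>p\<in>M. \<forall>u v. P p u v)"
proof
  assume \<Phi>: "\<forall>Y Z. smooth_on M Y \<longrightarrow> smooth_on M Z \<longrightarrow> (\<forall>p\<in>M. \<Phi> Y Z p)"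
  show "\<forall>p\<in>M. \<forall>u v. P p u v"
  proof (intro ballI allI)
    fix p u v assume "p \<in> M"
    then show "P p u v"
      using \<Phi> assms[of "\<lambda>_. u" "\<lambda>_. v" p] by simp
  qed
qed (use assms in blast)

lemma all_fields3_iff:
  assumes "\<And>Y Z W p. smooth_on M Y \<Longrightarrow> smooth_on M Z \<Longrightarrow> smooth_on M W \<Longrightarrow> p \<in> M \<Longrightarrow>
    \<Phi> Y Z W p \<longleftrightarrow> P p (Y p) (Z p) (W p)"
  shows "(\<forall>Y Z W. smooth_on M Y \<longrightarrow> smooth_on M Z \<longrightarrow> smooth_on M W \<longrightarrow> (\<forall>p\<in>M. \<Phi> Y Z W p))
    \<longleftrightarrow> (\<forall>p\<in>M. \<forall>u v w. P p u v w)"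
proof
  assume \<Phi>: "\<forall>Y Z W. smooth_on M Y \<longrightarrow> smooth_on M Z \<longrightarrow> smooth_on M W \<longrightarrow> (\<forall>p\<in>M. \<Phi> Y Z W p)"
  show "\<forall>p\<in>M. \<forall>u v w. P p u v w"
  proof (intro ballI allI)
    fix p u v w assume "p \<in> M"
    then show "P p u v w"
      using \<Phi> assms[of "\<lambda>_. u" "\<lambda>_. v" "\<lambda>_. w" p] by simp
  qed
qed (use assms in blast)

text \<open>The factor stays fixed on both sides, so that the Killing case is the instance
  \<open>\<eta> = 0\<close>.\<close>

lemma homothetic_with_factor_iff:
  fixes X :: "real^3 \<Rightarrow> real^3"
  assumes X: "smooth_on M X"
  defines "A \<equiv> \<lambda>p. X p $ 1" and "B \<equiv> \<lambda>p. X p $ 2" and "C \<equiv> \<lambda>p. X p $ 3"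
  shows "(\<forall>Y Z. smooth_on M Y \<longrightarrow> smooth_on M Z \<longrightarrow>
      (\<forall>p\<in>M. lie_deriv_form X (walker_N b) Y Z p = \<eta> * walker_N b p (Y p) (Z p))) \<longleftrightarrow>
    (\<forall>p\<in>M. pd 1 C p = 0 \<and> pd 2 C p + pd 1 B p = 0 \<and> pd 3 C p + pd 1 A p = \<eta>
      \<and> 2 * pd 2 B p = \<eta> \<and> pd 2 A p + pd 3 B p - 2 / b\<^sup>2 * (exp (b * p $ 2) * pd 2 C p) = 0
      \<and> exp (b * p $ 2) * (b * B p + 2 * pd 3 C p - \<eta>) - b\<^sup>2 * pd 3 A p = 0)"
proof -
  define P where "P = (\<lambda>p u v. - 2 * exp (b * p $ 2) / b * X p $ 2 * u $ 3 * v $ 3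
      + walker_N b p (frechet_derivative X (at p) u) v + walker_N b p u (frechet_derivative X (at p) v)
      = \<eta> * walker_N b p u v)"
  have "(\<forall>Y Z. smooth_on M Y \<longrightarrow> smooth_on M Z \<longrightarrow>
      (\<forall>p\<in>M. lie_deriv_form X (walker_N b) Y Z p = \<eta> * walker_N b p (Y p) (Z p))) \<longleftrightarrow>
    (\<forall>p\<in>M. \<forall>u v. P p u v)"
    by (rule all_fields_iff, unfold P_def)
      (subst lie_deriv_form_walker_N[OF b smooth_has_derivative[OF X] smooth_has_derivative
        smooth_has_derivative], simp_all)
  moreover have "(\<forall>u v. P p u v) \<longleftrightarrow> pd 1 C p = 0 \<and> pd 2 C p + pd 1 B p = 0 \<and> pd 3 C p + pd 1 A p = \<eta>
      \<and> 2 * pd 2 B p = \<eta> \<and> pd 2 A p + pd 3 B p - 2 / b\<^sup>2 * (exp (b * p $ 2) * pd 2 C p) = 0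
      \<and> exp (b * p $ 2) * (b * B p + 2 * pd 3 C p - \<eta>) - b\<^sup>2 * pd 3 A p = 0" (is "_ \<longleftrightarrow> ?eqs")
    if p: "p \<in> M" for p
  proof -
    \<comment> \<open>The coefficient of \<open>dy^2\<close>. Kept opaque, it makes both sides of
      \<open>P\<close> bilinear in \<open>u\<close> and \<open>v\<close>, and the equivalence
      becomes a comparison of coefficients on the coordinate fields.\<close>
    define f where "f = - 2 / b\<^sup>2 * exp (b * p $ 2)"
    have P: "P p u v \<longleftrightarrow> f * (b * B p) * u $ 3 * v $ 3
      + (u $ 1 * pd 1 A p + u $ 2 * pd 2 A p + u $ 3 * pd 3 A p) * v $ 3
      + (u $ 1 * pd 1 C p + u $ 2 * pd 2 C p + u $ 3 * pd 3 C p) * v $ 1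
      + (u $ 1 * pd 1 B p + u $ 2 * pd 2 B p + u $ 3 * pd 3 B p) * v $ 2
      + f * (u $ 1 * pd 1 C p + u $ 2 * pd 2 C p + u $ 3 * pd 3 C p) * v $ 3
      + (v $ 1 * pd 1 A p + v $ 2 * pd 2 A p + v $ 3 * pd 3 A p) * u $ 3
      + (v $ 1 * pd 1 C p + v $ 2 * pd 2 C p + v $ 3 * pd 3 C p) * u $ 1
      + (v $ 1 * pd 1 B p + v $ 2 * pd 2 B p + v $ 3 * pd 3 B p) * u $ 2
      + f * (v $ 1 * pd 1 C p + v $ 2 * pd 2 C p + v $ 3 * pd 3 C p) * u $ 3
      = \<eta> * (u $ 1 * v $ 3 + u $ 3 * v $ 1 + u $ 2 * v $ 2 + f * u $ 3 * v $ 3)" for u v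
    proof -
      have "- 2 * exp (b * p $ 2) / b * X p $ 2 = f * (b * B p)"
        using b by (simp add: f_def B_def power2_eq_square)
      then show ?thesis
        unfolding P_def walker_N_def walker_metric_def frechet_derivative_component[OF X p]
        by (simp add: A_def B_def C_def f_def algebra_simps)
    qed
    have e33: "exp (b * p $ 2) * (b * B p + 2 * pd 3 C p - \<eta>) - b\<^sup>2 * pd 3 A p = 0 \<longleftrightarrow>
      f * (b * B p + 2 * pd 3 C p - \<eta>) + 2 * pd 3 A p = 0"
    proof -
      have "f * (b * B p + 2 * pd 3 C p - \<eta>) + 2 * pd 3 A p =
        - 2 / b\<^sup>2 * (exp (b * p $ 2) * (b * B p + 2 * pd 3 C p - \<eta>) - b\<^sup>2 * pd 3 A p)"
        using b by (simp add: f_def right_diff_distrib)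
      then show ?thesis
        using b by simp
    qed
    have e23: "pd 2 A p + pd 3 B p - 2 / b\<^sup>2 * (exp (b * p $ 2) * pd 2 C p) = 0 \<longleftrightarrow>
      pd 2 A p + pd 3 B p + f * pd 2 C p = 0"
      by (simp add: f_def mult.assoc)
    show ?thesis
      unfolding e33 e23
    proof
      assume H: "\<forall>u v. P p u v"
      note H' = H[rule_format, unfolded P]
      show "pd 1 C p = 0 \<and> pd 2 C p + pd 1 B p = 0 \<and> pd 3 C p + pd 1 A p = \<eta>
        \<and> 2 * pd 2 B p = \<eta> \<and> pd 2 A p + pd 3 B p + f * pd 2 C p = 0
        \<and> f * (b * B p + 2 * pd 3 C p - \<eta>) + 2 * pd 3 A p = 0"
        using H'[of "axis 1 1" "axis 1 1"] H'[of "axis 1 1" "axis 2 1"] H'[of "axis 1 1" "axis 3 1"]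
          H'[of "axis 2 1" "axis 2 1"] H'[of "axis 2 1" "axis 3 1"] H'[of "axis 3 1" "axis 3 1"]
        by (simp add: axis_def algebra_simps)
    next
      assume "pd 1 C p = 0 \<and> pd 2 C p + pd 1 B p = 0 \<and> pd 3 C p + pd 1 A p = \<eta>
        \<and> 2 * pd 2 B p = \<eta> \<and> pd 2 A p + pd 3 B p + f * pd 2 C p = 0
        \<and> f * (b * B p + 2 * pd 3 C p - \<eta>) + 2 * pd 3 A p = 0"
      then have e: "pd 1 C p = 0" "pd 1 B p = - pd 2 C p" "pd 1 A p = \<eta> - pd 3 C p" "pd 2 B p = \<eta> / 2"
        "pd 2 A p = - pd 3 B p - f * pd 2 C p" "pd 3 A p = - f * (b * B p + 2 * pd 3 C p - \<eta>) / 2"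
        by auto
      show "\<forall>u v. P p u v"
        unfolding P e by (intro allI) (simp add: field_simps)
    qed
  qed
  ultimately show ?thesis
    by simp
qed

lemma killing_solution_iff:
  fixes X :: "real^3 \<Rightarrow> real^3"
  assumes X: "smooth_on M X"
  shows "(\<forall>Y Z. smooth_on M Y \<longrightarrow> smooth_on M Z \<longrightarrow>
      (\<forall>p\<in>M. lie_deriv_form X (walker_N b) Y Z p = \<eta> * walker_N b p (Y p) (Z p))) \<longleftrightarrow>
    \<eta> = 0 \<and> (\<exists>c1 c2 c3. \<forall>p\<in>M.
      X p $ 1 = c1 * p $ 1 + c2 \<and> X p $ 2 = 2 * c1 / b \<and> X p $ 3 = - c1 * p $ 3 + c3)"
  unfolding homothetic_with_factor_iff[OF X]
proof (rule iffI, goal_cases)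
  case 1
  then show ?case
    by (intro killing_system smooth_on_M_nth X) blast+
next
  case 2
  then obtain c1 c2 c3 where eq: "\<And>p. p \<in> M \<Longrightarrow> X p $ 1 = c1 * p $ 1 + c2"
    "\<And>p. p \<in> M \<Longrightarrow> X p $ 2 = 2 * c1 / b" "\<And>p. p \<in> M \<Longrightarrow> X p $ 3 = - c1 * p $ 3 + c3"
    and \<eta>: "\<eta> = 0"
    by blast
  have "pd i (\<lambda>q. X q $ 1) p = c1 * (if i = 1 then 1 else 0) + 0"
    "pd i (\<lambda>q. X q $ 2) p = 0" "pd i (\<lambda>q. X q $ 3) p = - c1 * (if i = 3 then 1 else 0) + 0"
    if p: "p \<in> M" for p i
    by (rule pd_M_eq[OF _ p], erule eq, intro has_pd_intros)+
  then show ?case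
    using eq b \<eta> by auto
qed

text \<open>The Ricci tensor sees only third components of vectors. Hence \<open>X $ 1\<close> drops
  out altogether, and \<open>B\<close> enters undifferentiated, through the derivative of the
  exponential.\<close>

lemma ricci_collineation_eqs:
  fixes X :: "real^3 \<Rightarrow> real^3"
  assumes X: "smooth_on M X"
  defines "B \<equiv> \<lambda>p. X p $ 2" and "C \<equiv> \<lambda>p. X p $ 3"
  shows "ricci_collineation M (walker_N b) X \<longleftrightarrow>
    (\<forall>p\<in>M. pd 1 C p = 0 \<and> pd 2 C p = 0 \<and> b * B p + 2 * pd 3 C p = 0)"
proof -
  define P where "P = (\<lambda>(p::real^3) (u::real^3) (v::real^3). exp (b * p $ 2) * (b * B p * u $ 3 * v $ 3
      + (u $ 1 * pd 1 C p + u $ 2 * pd 2 C p + u $ 3 * pd 3 C p) * v $ 3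
      + u $ 3 * (v $ 1 * pd 1 C p + v $ 2 * pd 2 C p + v $ 3 * pd 3 C p)) = 0)"
  have "ricci_collineation M (walker_N b) X \<longleftrightarrow> (\<forall>p\<in>M. \<forall>u v. P p u v)"
    unfolding ricci_collineation_def
    by (rule all_fields_iff, unfold P_def)
      (subst lie_deriv_form_ricci_walker_N[OF b smooth_has_derivative[OF X] smooth_has_derivative
        smooth_has_derivative], simp_all add: frechet_derivative_component[OF X] B_def C_def)
  moreover have "(\<forall>u v. P p u v) \<longleftrightarrow> pd 1 C p = 0 \<and> pd 2 C p = 0 \<and> b * B p + 2 * pd 3 C p = 0" for p
  proof
    assume H: "\<forall>u v. P p u v"
    show "pd 1 C p = 0 \<and> pd 2 C p = 0 \<and> b * B p + 2 * pd 3 C p = 0"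
      using H[rule_format, unfolded P_def, of "axis 1 1" "axis 3 1"]
        H[rule_format, unfolded P_def, of "axis 2 1" "axis 3 1"]
        H[rule_format, unfolded P_def, of "axis 3 1" "axis 3 1"]
      by (simp add: axis_def)
  next
    assume "pd 1 C p = 0 \<and> pd 2 C p = 0 \<and> b * B p + 2 * pd 3 C p = 0"
    then have e: "pd 1 C p = 0" "pd 2 C p = 0" "b * B p = - 2 * pd 3 C p"
      by auto
    show "\<forall>u v. P p u v"
      unfolding P_def e by (simp add: algebra_simps)
  qed
  ultimately show ?thesis
    by simp
qed

lemma curvature_collineation_eqs:
  fixes X :: "real^3 \<Rightarrow> real^3"
  assumes X: "smooth_on M X"
  defines "A \<equiv> \<lambda>p. X p $ 1" and "B \<equiv> \<lambda>p. X p $ 2" and "C \<equiv> \<lambda>p. X p $ 3"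
  shows "curvature_collineation M (walker_N b) X \<longleftrightarrow>
    (\<forall>p\<in>M. pd 1 B p = 0 \<and> pd 1 C p = 0 \<and> pd 2 C p = 0 \<and> b * B p + 2 * pd 3 C p = 0
      \<and> pd 2 A p + pd 3 B p = 0 \<and> pd 1 A p = b * B p + 2 * pd 2 B p + pd 3 C p)"
proof -
  define D where "D = (\<lambda>p. frechet_derivative X (at p))"
  define P where "P = (\<lambda>p u v w. (b * B p) *\<^sub>R walker_curv u v w - D p (walker_curv u v w)
      + walker_curv (D p u) v w + walker_curv u (D p v) w + walker_curv u v (D p w) = 0)"
  have "curvature_collineation M (walker_N b) X \<longleftrightarrow> (\<forall>p\<in>M. \<forall>u v w. P p u v w)"
    unfolding curvature_collineation_def
    by (rule all_fields3_iff, unfold P_def D_def)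
      (subst lie_deriv_curvature_walker_N[OF b smooth_has_derivative[OF X] smooth_has_derivative
        smooth_has_derivative smooth_has_derivative], simp_all add: B_def)
  moreover have "(\<forall>u v w. P p u v w) \<longleftrightarrow> pd 1 B p = 0 \<and> pd 1 C p = 0 \<and> pd 2 C p = 0
      \<and> b * B p + 2 * pd 3 C p = 0 \<and> pd 2 A p + pd 3 B p = 0
      \<and> pd 1 A p = b * B p + 2 * pd 2 B p + pd 3 C p"
    if p: "p \<in> M" for p
  proof -
    have D: "D p v $ 1 = v $ 1 * pd 1 A p + v $ 2 * pd 2 A p + v $ 3 * pd 3 A p"
      "D p v $ 2 = v $ 1 * pd 1 B p + v $ 2 * pd 2 B p + v $ 3 * pd 3 B p"
      "D p v $ 3 = v $ 1 * pd 1 C p + v $ 2 * pd 2 C p + v $ 3 * pd 3 C p" for v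
      by (simp_all add: D_def A_def B_def C_def frechet_derivative_component[OF X p])
    show ?thesis
    proof
      assume H: "\<forall>u v w. P p u v w"
      note H' = H[rule_format, unfolded P_def vec_eq_iff forall_3]
      show "pd 1 B p = 0 \<and> pd 1 C p = 0 \<and> pd 2 C p = 0
        \<and> b * B p + 2 * pd 3 C p = 0 \<and> pd 2 A p + pd 3 B p = 0
        \<and> pd 1 A p = b * B p + 2 * pd 2 B p + pd 3 C p"
        \<comment> \<open>The first triple gives \<open>pd 1 B = 0\<close>, the second
          \<open>pd 1 C = 0\<close>, the third \<open>pd 2 C = 0\<close> and the formula for
          \<open>pd 1 A\<close>, and the last the two remaining equations.\<close>
        using H'[of "axis 1 1" "axis 3 1" "axis 3 1"] H'[of "axis 1 1" "axis 2 1" "axis 3 1"]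
          H'[of "axis 2 1" "axis 3 1" "axis 2 1"] H'[of "axis 2 1" "axis 3 1" "axis 3 1"]
        by (simp add: walker_curv_def D axis_def algebra_simps)
    next
      assume "pd 1 B p = 0 \<and> pd 1 C p = 0 \<and> pd 2 C p = 0
        \<and> b * B p + 2 * pd 3 C p = 0 \<and> pd 2 A p + pd 3 B p = 0
        \<and> pd 1 A p = b * B p + 2 * pd 2 B p + pd 3 C p"
      then have e: "pd 1 B p = 0" "pd 1 C p = 0" "pd 2 C p = 0" "b * B p = - 2 * pd 3 C p"
        "pd 2 A p = - pd 3 B p" "pd 1 A p = 2 * pd 2 B p - pd 3 C p"
        by auto
      show "\<forall>u v w. P p u v w"
        unfolding P_def vec_eq_iff forall_3
        by (simp add: walker_curv_def D e algebra_simps)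
    qed
  qed
  ultimately show ?thesis
    by simp
qed

lemma ricci_collineation_iff:
  fixes X :: "real^3 \<Rightarrow> real^3"
  assumes X: "smooth_on M X"
  shows "ricci_collineation M (walker_N b) X \<longleftrightarrow> (\<exists>f1 :: real \<Rightarrow> real. smooth_on K f1 \<and> (\<forall>p\<in>M.
    X p $ 2 = - (2 / b) * deriv f1 (p $ 3) \<and> X p $ 3 = f1 (p $ 3)))"
  unfolding ricci_collineation_eqs[OF X]
proof (rule iffI, goal_cases)
  case 1
  then obtain f1 where f1: "smooth_on K f1" "\<forall>p\<in>M. X p $ 3 = f1 (p $ 3)"
    using function_of_third[OF smooth_on_M_nth[OF X], of 3] by blast
  have "X p $ 2 = - (2 / b) * deriv f1 (p $ 3)" if "p \<in> M" for p
  proof -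
    have "pd 3 (\<lambda>q. X q $ 3) p = deriv f1 (p $ 3)"
      using pd_compose_third[OF f1(1), of "\<lambda>q. X q $ 3" p 3] f1(2) that by simp
    then show ?thesis
      using 1 that b by (simp add: field_simps add_eq_0_iff2)
  qed
  then show ?case
    using f1 by blast
next
  case 2
  then obtain f1 where f1: "smooth_on K f1" "\<forall>p\<in>M. X p $ 3 = f1 (p $ 3)"
    and B: "\<forall>p\<in>M. X p $ 2 = - (2 / b) * deriv f1 (p $ 3)"
    by blast
  have "pd i (\<lambda>q. X q $ 3) p = (if i = 3 then deriv f1 (p $ 3) else 0)" if "p \<in> M" for p i
    by (rule pd_compose_third[OF f1(1) _ that]) (use f1 in blast)
  then show ?case
    using B b by simp
qed

lemma curvature_collineation_iff:
  fixes X :: "real^3 \<Rightarrow> real^3"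
  assumes X: "smooth_on M X"
  shows "curvature_collineation M (walker_N b) X \<longleftrightarrow> (\<exists>f1 f2 :: real \<Rightarrow> real.
    smooth_on K f1 \<and> smooth_on K f2 \<and> (\<forall>p\<in>M.
    X p $ 1 = f2 (p $ 3) - deriv f1 (p $ 3) * p $ 1 + (2 / b) * deriv (deriv f1) (p $ 3) * p $ 2
    \<and> X p $ 2 = - (2 / b) * deriv f1 (p $ 3) \<and> X p $ 3 = f1 (p $ 3)))"
  unfolding curvature_collineation_eqs[OF X]
proof (rule iffI, goal_cases)
  case 1
  have K: "open K"
    using intervals by (simp add: open_interval_def)
  obtain f1 where f1: "smooth_on K f1" "\<And>p. p \<in> M \<Longrightarrow> X p $ 3 = f1 (p $ 3)"
    using function_of_third[OF smooth_on_M_nth[OF X], of 3] 1 by blast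
  note sm = f1(1) smooth_on_deriv[OF K f1(1)] smooth_on_deriv[OF K smooth_on_deriv[OF K f1(1)]]
  have C3: "pd 3 (\<lambda>q. X q $ 3) p = deriv f1 (p $ 3)" if "p \<in> M" for p
    using pd_compose_third[OF sm(1) f1(2) that, of 3] by simp
  have B: "X p $ 2 = - (2 / b) * deriv f1 (p $ 3)" if "p \<in> M" for p
  proof -
    have "b * X p $ 2 + 2 * deriv f1 (p $ 3) = 0"
      using 1 C3 that by metis
    then show ?thesis
      using b by (simp add: field_simps add_eq_0_iff2)
  qed
  have d2: "has_pd i (\<lambda>q. deriv f1 (q $ 3)) p (if i = 3 then deriv (deriv f1) (p $ 3) else 0)"
    and d3: "has_pd i (\<lambda>q. deriv (deriv f1) (q $ 3)) p (if i = 3 then deriv (deriv (deriv f1)) (p $ 3) else 0)"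
    if "p \<in> M" for p i
  proof -
    have y: "p $ 3 \<in> K"
      using that by (simp add: M coord_box_def)
    show "has_pd i (\<lambda>q. deriv f1 (q $ 3)) p (if i = 3 then deriv (deriv f1) (p $ 3) else 0)"
      "has_pd i (\<lambda>q. deriv (deriv f1) (q $ 3)) p (if i = 3 then deriv (deriv (deriv f1)) (p $ 3) else 0)"
      by (rule has_pd_compose_coord smooth_on_has_deriv y sm)+
  qed
  have Bi: "pd i (\<lambda>q. X q $ 2) p = - (2 / b) * (if i = 3 then deriv (deriv f1) (p $ 3) else 0)"
    if "p \<in> M" for p i
    by (rule pd_M_eq[OF B that has_pd_cmult[OF d2[OF that]]])
  \<comment> \<open>The first component minus the asserted terms in \<open>t\<close> and
    \<open>x\<close>; it must turn out to depend on \<open>y\<close> only.\<close>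
  define H where "H = (\<lambda>p. X p $ 1 + deriv f1 (p $ 3) * p $ 1 + (- (2 / b)) * (deriv (deriv f1) (p $ 3) * p $ 2))"
  have H: "has_pd i H p 0" if p: "p \<in> M" and i: "i \<in> {1, 2}" for p i
  proof -
    have "has_pd i H p (pd i (\<lambda>p. X p $ 1) p
       + (deriv f1 (p $ 3) * (if i = 1 then 1 else 0) + (if i = 3 then deriv (deriv f1) (p $ 3) else 0) * p $ 1)
       + (- (2 / b)) * (deriv (deriv f1) (p $ 3) * (if i = 2 then 1 else 0)
         + (if i = 3 then deriv (deriv (deriv f1)) (p $ 3) else 0) * p $ 2))"
      unfolding H_def
      by (intro has_pd_add has_pd_cmult has_pd_mult has_pd_coord d2 d3 has_pd_M smooth_on_M_nth X p)
    moreover have "\<dots> = 0"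
    proof -
      have "pd 1 (\<lambda>p. X p $ 1) p = - deriv f1 (p $ 3)"
        using 1 p C3[OF p] Bi[OF p, of 2] B[OF p] b by simp
      moreover have "pd 2 (\<lambda>p. X p $ 1) p = 2 / b * deriv (deriv f1) (p $ 3)"
        using 1 p Bi[OF p, of 3] by (simp add: add_eq_0_iff2)
      ultimately show ?thesis
        using i by auto
    qed
    ultimately show ?thesis
      by (simp only:)
  qed
  obtain t x where tx: "\<And>p. p \<in> M \<Longrightarrow> vector [t, x, p $ 3] \<in> M"
    "\<And>F. smooth_on M F \<Longrightarrow> smooth_on K (\<lambda>y. F (vector [t, x, y]) :: real)"
    using obtain_section by blast
  \<comment> \<open>\<open>H\<close> restricted to the section. There \<open>t\<close> and
    \<open>x\<close> are constants, so smoothness follows from sums and constant multiples of smooth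
    functions of \<open>y\<close>.\<close>
  define f2 where "f2 = (\<lambda>y. X (vector [t, x, y]) $ 1 + t * deriv f1 y + (- (2 / b) * x) * deriv (deriv f1) y)"
  have "smooth_on K f2"
    unfolding f2_def
    by (intro smooth_on_add[OF K] smooth_on_bounded_linear[OF bounded_linear_mult_right K]
        sm tx(2)[OF smooth_on_M_nth[OF X]])
  moreover have "X p $ 1 = f2 (p $ 3) - deriv f1 (p $ 3) * p $ 1 + (2 / b) * deriv (deriv f1) (p $ 3) * p $ 2"
    if p: "p \<in> M" for p
  proof -
    have "H p = H (vector [t, x, p $ 3])"
    proof (rule eq_if_pd_zero[OF H p tx(1)[OF p]])
      show "p $ i = vector [t, x, p $ 3] $ i" if "i \<notin> {1, 2}" for i
        using that exhaust_3[of i] by auto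
    qed auto
    also have "\<dots> = f2 (p $ 3)"
      by (simp add: H_def f2_def)
    finally show ?thesis
      by (simp add: H_def algebra_simps)
  qed
  ultimately show ?case
    using f1 B by blast
next
  case 2
  have K: "open K"
    using intervals by (simp add: open_interval_def)
  obtain f1 f2 where f: "smooth_on K f1" "smooth_on K f2"
    and A: "\<And>p. p \<in> M \<Longrightarrow> X p $ 1 = f2 (p $ 3) - deriv f1 (p $ 3) * p $ 1
        + (2 / b) * (deriv (deriv f1) (p $ 3) * p $ 2)"
    and B: "\<And>p. p \<in> M \<Longrightarrow> X p $ 2 = - (2 / b) * deriv f1 (p $ 3)"
    and C: "\<And>p. p \<in> M \<Longrightarrow> X p $ 3 = f1 (p $ 3)"
    using 2 by (auto simp: mult.assoc)
  note sm = f smooth_on_deriv[OF K f(1)] smooth_on_deriv[OF K smooth_on_deriv[OF K f(1)]]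
  have d: "has_pd i (\<lambda>q. f2 (q $ 3)) p (if i = 3 then deriv f2 (p $ 3) else 0)"
    "has_pd i (\<lambda>q. deriv f1 (q $ 3)) p (if i = 3 then deriv (deriv f1) (p $ 3) else 0)"
    "has_pd i (\<lambda>q. deriv (deriv f1) (q $ 3)) p (if i = 3 then deriv (deriv (deriv f1)) (p $ 3) else 0)"
    if "p \<in> M" for p i
  proof -
    have y: "p $ 3 \<in> K"
      using that by (simp add: M coord_box_def)
    show "has_pd i (\<lambda>q. f2 (q $ 3)) p (if i = 3 then deriv f2 (p $ 3) else 0)"
      "has_pd i (\<lambda>q. deriv f1 (q $ 3)) p (if i = 3 then deriv (deriv f1) (p $ 3) else 0)"
      "has_pd i (\<lambda>q. deriv (deriv f1) (q $ 3)) p (if i = 3 then deriv (deriv (deriv f1)) (p $ 3) else 0)"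
      by (rule has_pd_compose_coord smooth_on_has_deriv y sm)+
  qed
  have "pd i (\<lambda>q. X q $ 1) p = (if i = 3 then deriv f2 (p $ 3) else 0)
       - (deriv f1 (p $ 3) * (if i = 1 then 1 else 0) + (if i = 3 then deriv (deriv f1) (p $ 3) else 0) * p $ 1)
       + (2 / b) * (deriv (deriv f1) (p $ 3) * (if i = 2 then 1 else 0)
         + (if i = 3 then deriv (deriv (deriv f1)) (p $ 3) else 0) * p $ 2)" if p: "p \<in> M" for p i
    by (rule pd_M_eq[OF A p], assumption)
      (intro has_pd_add has_pd_diff has_pd_cmult has_pd_mult has_pd_coord d p)
  moreover have "pd i (\<lambda>q. X q $ 2) p = - (2 / b) * (if i = 3 then deriv (deriv f1) (p $ 3) else 0)"
    if "p \<in> M" for p i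
    by (rule pd_M_eq[OF B that has_pd_cmult[OF d(2)[OF that]]])
  moreover have "pd i (\<lambda>q. X q $ 3) p = (if i = 3 then deriv f1 (p $ 3) else 0)" if "p \<in> M" for p i
    by (rule pd_compose_third[OF f(1) C that])
  ultimately show ?case
    using B b by simp
qed

lemma affine_field_iff:
  fixes X :: "real^3 \<Rightarrow> real^3"
  assumes X: "smooth_on M X"
  shows "affine_field M (walker_N b) X \<longleftrightarrow> (\<exists>c1 c2 c3 c4. \<forall>p\<in>M.
    X p $ 1 = c1 * p $ 1 + c2 + c4 * p $ 3 \<and> X p $ 2 = 2 * c1 / b \<and> X p $ 3 = - c1 * p $ 3 + c3)"
proof -
  define D where "D = (\<lambda>p. frechet_derivative X (at p))"
  define P where "P = (\<lambda>p u v. (b * X p $ 2) *\<^sub>R walker_gamma b p u v - D p (walker_gamma b p u v)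
      + walker_gamma b p (D p u) v + walker_gamma b p u (D p v) + hess X p u v = 0)"
  have aff: "affine_field M (walker_N b) X \<longleftrightarrow> (\<forall>p\<in>M. \<forall>u v. P p u v)"
    unfolding affine_field_def
    by (rule all_fields_iff, unfold P_def D_def)
      (subst lie_deriv_levi_civita_walker_N[OF b open_M _ X], simp_all)
  note sm = smooth_on_M_nth[OF X]
  note comp = frechet_derivative_component[OF X] hess_nth[OF open_M X] sum_3
  show ?thesis
    unfolding aff
  proof (rule iffI, goal_cases)
    case 1
    \<comment> \<open>The factor \<open>b\<close> clears the denominator in
      \<open>walker_gamma\<close>. In the cases below, \<open>eqs[of p i j l]\<close> is the
      component with upper index \<open>l\<close> on the coordinate fields \<open>i\<close> and
      \<open>j\<close>.\<close>
    have eq: "b * (((b * X p $ 2) *\<^sub>R walker_gamma b p (axis i 1) (axis j 1) - D p (walker_gamma b p (axis i 1) (axis j 1))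
      + walker_gamma b p (D p (axis i 1)) (axis j 1) + walker_gamma b p (axis i 1) (D p (axis j 1))
      + hess X p (axis i 1) (axis j 1)) $ l) = 0" if "p \<in> M" for p i j l
      using 1 that by (simp add: P_def)
    note eqs = eq[unfolded walker_gamma_def walker_bil_def D_def]
    show ?case
    proof (rule affine_system[OF sm sm sm], goal_cases)
      case (1 p)
      then show ?case using eqs[of p 1 2 3] b by (simp add: comp axis_def)
    next
      case (2 p)
      then show ?case using eqs[of p 2 2 3] b by (simp add: comp axis_def)
    next
      case (3 p)
      then show ?case using eqs[of p 2 3 3] b by (simp add: comp axis_def algebra_simps)
    next
      case (4 p)
      then show ?case using eqs[of p 3 3 3] b by (simp add: comp axis_def algebra_simps)
    next
      case (5 p)
      then show ?case using eqs[of p 1 2 2] b by (simp add: comp axis_def)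
    next
      case (6 p)
      then show ?case using eqs[of p 2 2 2] b by (simp add: comp axis_def)
    next
      case (7 p)
      then show ?case using eqs[of p 2 3 2] b by (simp add: comp axis_def algebra_simps)
    next
      case (8 p)
      then show ?case using eqs[of p 3 3 2] b by (simp add: comp axis_def algebra_simps)
    next
      case (9 p)
      then show ?case using eqs[of p 1 2 1] b by (simp add: comp axis_def algebra_simps)
    next
      case (10 p)
      then show ?case using eqs[of p 2 2 1] b by (simp add: comp axis_def algebra_simps)
    next
      case (11 p)
      then show ?case using eqs[of p 1 3 1] b by (simp add: comp axis_def algebra_simps)
    next
      case (12 p)
      then show ?case using eqs[of p 2 3 1] b by (simp add: comp axis_def algebra_simps)
    next
      case (13 p)
      then show ?case using eqs[of p 3 3 1] b by (simp add: comp axis_def algebra_simps)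
    next
      case (14 p)
      then show ?case using eqs[of p 1 3 3] b by (simp add: comp axis_def)
    qed
  next
    case 2
    then obtain c1 c2 c3 c4 where A: "\<And>p. p \<in> M \<Longrightarrow> X p $ 1 = c1 * p $ 1 + c2 + c4 * p $ 3"
      and B: "\<And>p. p \<in> M \<Longrightarrow> X p $ 2 = 2 * c1 / b" and C: "\<And>p. p \<in> M \<Longrightarrow> X p $ 3 = - c1 * p $ 3 + c3"
      by blast
    have d: "pd i (\<lambda>q. X q $ 1) p = c1 * (if i = 1 then 1 else 0) + 0 + c4 * (if i = 3 then 1 else 0)"
      "pd i (\<lambda>q. X q $ 2) p = 0" "pd i (\<lambda>q. X q $ 3) p = - c1 * (if i = 3 then 1 else 0) + 0"
      if p: "p \<in> M" for p i
      by (rule pd_M_eq[OF _ p], erule A B C, intro has_pd_intros)+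
    have dd: "pd i (pd j (\<lambda>q. X q $ 1)) p = 0" "pd i (pd j (\<lambda>q. X q $ 2)) p = 0"
      "pd i (pd j (\<lambda>q. X q $ 3)) p = 0" if p: "p \<in> M" for p i j
      by (rule pd_const_M[OF d(1) p], assumption) (rule pd_const_M[OF d(2) p], assumption,
        rule pd_const_M[OF d(3) p], assumption)
    show ?case
    proof (intro ballI allI)
      fix p u v assume p: "p \<in> M"
      show "P p u v"
        unfolding P_def D_def vec_eq_iff forall_3
        using b by (simp add: comp p d dd B walker_gamma_def walker_bil_def field_simps)
    qed
  qed
qed

end

theorem theorem4p1:
  fixes b :: real and I J K :: "real set" and M :: "(real^3) set"
    and g :: "real^3 \<Rightarrow> real^3 \<Rightarrow> real^3 \<Rightarrow> real"
    and X :: "real^3 \<Rightarrow> real^3"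
  assumes "b \<noteq> 0"
    and "open_interval I" and "open_interval J" and "open_interval K"
    and "M = coord_box I J K"
    and "g = walker_N b"
    and "smooth_on M X"
  shows "(homothetic M g X \<longleftrightarrow> (\<exists>c1 c2 c3. \<forall>p\<in>M.
            X p $ 1 = c1 * p $ 1 + c2 \<and> X p $ 2 = 2 * c1 / b \<and> X p $ 3 = - c1 * p $ 3 + c3))
       \<and> (killing M g X \<longleftrightarrow> (\<exists>c1 c2 c3. \<forall>p\<in>M.
            X p $ 1 = c1 * p $ 1 + c2 \<and> X p $ 2 = 2 * c1 / b \<and> X p $ 3 = - c1 * p $ 3 + c3))
       \<and> (affine_field M g X \<longleftrightarrow> (\<exists>c1 c2 c3 c4. \<forall>p\<in>M.
            X p $ 1 = c1 * p $ 1 + c2 + c4 * p $ 3 \<and> X p $ 2 = 2 * c1 / b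
            \<and> X p $ 3 = - c1 * p $ 3 + c3))
       \<and> (ricci_collineation M g X \<longleftrightarrow> (\<exists>f1 :: real \<Rightarrow> real. smooth_on K f1 \<and> (\<forall>p\<in>M.
            X p $ 2 = - (2 / b) * deriv f1 (p $ 3) \<and> X p $ 3 = f1 (p $ 3))))
       \<and> (curvature_collineation M g X \<longleftrightarrow> (\<exists>f1 f2 :: real \<Rightarrow> real.
            smooth_on K f1 \<and> smooth_on K f2 \<and> (\<forall>p\<in>M.
            X p $ 1 = f2 (p $ 3) - deriv f1 (p $ 3) * p $ 1 + (2 / b) * deriv (deriv f1) (p $ 3) * p $ 2
            \<and> X p $ 2 = - (2 / b) * deriv f1 (p $ 3) \<and> X p $ 3 = f1 (p $ 3))))"
proof -
  interpret walker_domain b I J K M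
    using assms by unfold_locales
  note X = \<open>smooth_on M X\<close>
  have "homothetic M g X \<longleftrightarrow> (\<exists>c1 c2 c3. \<forall>p\<in>M.
      X p $ 1 = c1 * p $ 1 + c2 \<and> X p $ 2 = 2 * c1 / b \<and> X p $ 3 = - c1 * p $ 3 + c3)"
    unfolding homothetic_def \<open>g = walker_N b\<close> killing_solution_iff[OF X] by blast
  moreover have "killing M g X \<longleftrightarrow> (\<exists>c1 c2 c3. \<forall>p\<in>M.
      X p $ 1 = c1 * p $ 1 + c2 \<and> X p $ 2 = 2 * c1 / b \<and> X p $ 3 = - c1 * p $ 3 + c3)"
    using killing_solution_iff[OF X, of 0] by (simp add: killing_def \<open>g = walker_N b\<close>)
  ultimately show ?thesis
    unfolding \<open>g = walker_N b\<close>
    using affine_field_iff[OF X] ricci_collineation_iff[OF X] curvature_collineation_iff[OF X] by blast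
qed

end
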